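(* Let $\alpha=1$ and let $\zeta$ and $V(x)=V_0\sin^2(kx)$ satisfy the hypotheses of the context, with $k>0$. Let $A=\frac{-V_0}{\alpha\beta(k;\epsilon)}$. If $A\ge2.46\,k^2$, then for offset size $B$ and nonlocality parameter $\epsilon$ sufficiently small the solution $\phi_\omega(x)e^{-i\omega t}$ is spectrally unstable with respect to perturbations of period $\frac{2\pi n}{k}$, $n\in\mathbb N$. That is: for fixed $k>0$ and $V_0$ there are $B_0,\epsilon_0>0$ such that whenever $0\le B<B_0$, $0\le\epsilon<\epsilon_0$ and $A\ge2.46\,k^2$, for every $n\in\mathbb N$ there exists $\lambda\in\sigma(JL)$ with $\mathrm{Re}(\lambda)>0$, where $\sigma(JL)$ is the spectrum of $JL$ as an operator on $L^2(S_{2\pi n})\times L^2(S_{2\pi n})$ with domain $H_2(S_{2\pi n})\times H_2(S_{2\pi n})$.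
   Context: $S_T$ is the circle of circumference $T$; $L^2(S_T)$ and the Sobolev spaces $H_s(S_T)$ consist of $T$-periodic complex-valued functions. Fourier transform: $\hat h(\tilde s)=\int_{\mathbb R}e^{-i\tilde sx}h(x)dx$. Hypotheses: $V(x)=V_0\sin^2(kx)$; $\zeta\ge0$ is even with $\|\zeta\|_{L^1(\mathbb R)}=1$; $\hat\zeta>0$ on $\mathbb R$; and $\hat\zeta(\tilde s)\le(1+|\tilde s|)^{-1/2-\tilde\epsilon}$ for all $\tilde s$, for some $\tilde\epsilon>0$. Kernel: $R(x;\epsilon)=\frac1\epsilon\zeta(\frac x\epsilon)$ for $\epsilon>0$; for $\epsilon=0$ it is the Dirac delta, i.e. convolution is the identity and $\beta(k;0)=1$ (local equation). Nonlocal Gross-Pitaevskii equation: $i\partial_t\psi=-\frac12\partial_x^2\psi+\alpha\psi(x)\int_{-\infty}^\infty R(x-y;\epsilon)|\psi(y)|^2dy+V(x)\psi$. With $\beta(k;\epsilon)=\int_{\mathbb R}R(x;\epsilon)\cos(2kx)dx$, $A=\frac{-V_0}{\alpha\beta(k;\epsilon)}$ and offset size $B\ge\max\{-A,0\}$, it has the explicit solution $\psi=\phi_\omega(x)e^{-i\omega t}$, $\phi_\omega(x)=\sqrt B\cos(kx)+i\sqrt{B+A}\sin(kx)$, $\omega=\frac{V_0+k^2}{2}+\alpha B-\frac{V_0}{2\beta(k;\epsilon)}$. Linearizing about this solution in the rotating frame, separating real and imaginary parts and rescaling $x\to kx$ gives (for $\alpha=1$) the operator $JL$ with $J=\begin{pmatrix}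 0 & 1 \\ -1 & 0 \end{pmatrix}$ and $$L\begin{pmatrix} w \\ z \end{pmatrix}=\begin{pmatrix} -\frac{k^2}{2}(\partial_x^2+1)w+2u_\omega\,R_{k,\epsilon}*(u_\omega w+v_\omega z) \\ -\frac{k^2}{2}(\partial_x^2+1)z+2v_\omega\,R_{k,\epsilon}*(u_\omega w+v_\omega z) \end{pmatrix},$$ where $u_\omega=\sqrt B\cos x$, $v_\omega=\sqrt{B+A}\sin x$, $R_{k,\epsilon}(x)=\frac1kR(\frac xk;\epsilon)$ and $*$ is convolution over $\mathbb R$. The solution is spectrally stable if $\mathrm{Re}(\lambda)\le0$ for all $\lambda\in\sigma(JL)$, and spectrally unstable otherwise. Perturbations of period $2\pi n/k$ in the original variable correspond to period $2\pi n$ after rescaling. *)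

theory Defs
  imports "HOL-Analysis.Analysis"
begin

section \<open>Lebesgue and Sobolev spaces on the circle of circumference \<open>T\<close>\<close>

text \<open>
  Elements of $L^2(S_T)$ are represented by Borel measurable, pointwise \<open>T\<close>-periodic functions
  on the line.  No quotient is taken; instead, equality is always read almost everywhere
  (\<open>ae_eq2\<close> below).
\<close>

definition L2_circle :: "real \<Rightarrow> (real \<Rightarrow> complex) set" where
  "L2_circle T = {f. f \<in> borel_measurable borel \<and> (\<forall>x. f (x + T) = f x) \<and>
     set_integrable lborel {0..T} (\<lambda>x. (norm (f x))\<^sup>2)}"

definition smooth_periodic :: "real \<Rightarrow> (real \<Rightarrow> complex) \<Rightarrow> bool" where
  "smooth_periodic T \<phi> \<longleftrightarrow> (\<forall>x. \<phi> (x + T) = \<phi> x) \<and>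
     (\<exists>D :: nat \<Rightarrow> real \<Rightarrow> complex. D 0 = \<phi> \<and>
        (\<forall>m x. (D m has_vector_derivative D (Suc m) x) (at x)))"

text \<open>\<open>g\<close> is a weak derivative of \<open>f\<close> on the circle; being periodic, the test functions
  produce no boundary terms.\<close>

definition weak_deriv :: "real \<Rightarrow> (real \<Rightarrow> complex) \<Rightarrow> (real \<Rightarrow> complex) \<Rightarrow> bool" where
  "weak_deriv T f g \<longleftrightarrow> (\<forall>\<phi>. smooth_periodic T \<phi> \<longrightarrow>
     (LINT x:{0..T}|lborel. f x * vector_derivative \<phi> (at x)) =
     - (LINT x:{0..T}|lborel. g x * \<phi> x))"

primrec sobolev :: "nat \<Rightarrow> real \<Rightarrow> (real \<Rightarrow> complex) set" where
  "sobolev 0 T = L2_circle T"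
| "sobolev (Suc s) T = {f \<in> L2_circle T. \<exists>g \<in> sobolev s T. weak_deriv T f g}"

text \<open>The weak derivative in $L^2(S_T)$ is unique up to null sets, so the choice only fixes
  a representative.\<close>

definition wderiv :: "real \<Rightarrow> (real \<Rightarrow> complex) \<Rightarrow> real \<Rightarrow> complex" where
  "wderiv T f = (SOME g. g \<in> L2_circle T \<and> weak_deriv T f g)"


section \<open>Spectrum of an operator on \<open>L\<^sup>2(S\<^sub>T) \<times> L\<^sup>2(S\<^sub>T)\<close>\<close>

type_synonym cfun2 = "(real \<Rightarrow> complex) \<times> (real \<Rightarrow> complex)"

definition ae_eq2 :: "cfun2 \<Rightarrow> cfun2 \<Rightarrow> bool" where
  "ae_eq2 f g \<longleftrightarrow> (AE x in lborel. fst f x = fst g x \<and> snd f x = snd g x)"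

definition L2_norm2 :: "real \<Rightarrow> cfun2 \<Rightarrow> real" where
  "L2_norm2 T f = sqrt ((LINT x:{0..T}|lborel. (norm (fst f x))\<^sup>2) +
                        (LINT x:{0..T}|lborel. (norm (snd f x))\<^sup>2))"

definition shifted :: "(cfun2 \<Rightarrow> cfun2) \<Rightarrow> complex \<Rightarrow> cfun2 \<Rightarrow> cfun2" where
  "shifted P lam f = (\<lambda>x. fst (P f) x - lam * fst f x, \<lambda>x. snd (P f) x - lam * snd f x)"

text \<open>\<open>P - lam\<close> maps the domain \<open>D\<close> bijectively (modulo null sets) onto
  $L^2(S_T) \times L^2(S_T)$, and the inverse is bounded.\<close>

definition resolvent_set :: "real \<Rightarrow> cfun2 set \<Rightarrow> (cfun2 \<Rightarrow> cfun2) \<Rightarrow> complex set" where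
  "resolvent_set T D P = {lam.
     (\<forall>f\<in>D. \<forall>g\<in>D. ae_eq2 (shifted P lam f) (shifted P lam g) \<longrightarrow> ae_eq2 f g) \<and>
     (\<forall>h \<in> L2_circle T \<times> L2_circle T. \<exists>f\<in>D. ae_eq2 (shifted P lam f) h) \<and>
     (\<exists>C. \<forall>f\<in>D. L2_norm2 T f \<le> C * L2_norm2 T (shifted P lam f))}"

definition spectrum :: "real \<Rightarrow> cfun2 set \<Rightarrow> (cfun2 \<Rightarrow> cfun2) \<Rightarrow> complex set" where
  "spectrum T D P = - resolvent_set T D P"


section \<open>The nonlocal interaction\<close>

definition fourier :: "(real \<Rightarrow> real) \<Rightarrow> real \<Rightarrow> complex" where
  "fourier h s = (LINT x|lborel. exp (- \<i> * of_real (s * x)) * of_real (h x))"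

definition admissible_kernel :: "(real \<Rightarrow> real) \<Rightarrow> bool" where
  "admissible_kernel \<zeta> \<longleftrightarrow>
     (\<forall>x. 0 \<le> \<zeta> x) \<and> (\<forall>x. \<zeta> (- x) = \<zeta> x) \<and>
     integrable lborel \<zeta> \<and> (LINT x|lborel. \<bar>\<zeta> x\<bar>) = 1 \<and>
     (\<forall>s. fourier \<zeta> s \<in> \<real> \<and> 0 < Re (fourier \<zeta> s)) \<and>
     (\<exists>e>0. \<forall>s. Re (fourier \<zeta> s) \<le> (1 + \<bar>s\<bar>) powr (- 1/2 - e))"

text \<open>For \<open>\<epsilon> = 0\<close> the kernel is the Dirac delta, which is not a function: \<open>kern\<close> and
  \<open>rkern\<close> are meaningful only for \<open>\<epsilon> > 0\<close>, and \<open>\<beta>\<close> and the convolution treat \<open>\<epsilon> = 0\<close>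
  separately.  The rescaled delta is again the delta.\<close>

definition kern :: "(real \<Rightarrow> real) \<Rightarrow> real \<Rightarrow> real \<Rightarrow> real" where
  "kern \<zeta> \<epsilon> x = 1 / \<epsilon> * \<zeta> (x / \<epsilon>)"

definition rkern :: "(real \<Rightarrow> real) \<Rightarrow> real \<Rightarrow> real \<Rightarrow> real \<Rightarrow> real" where
  "rkern \<zeta> k \<epsilon> x = 1 / k * kern \<zeta> \<epsilon> (x / k)"

definition beta :: "(real \<Rightarrow> real) \<Rightarrow> real \<Rightarrow> real \<Rightarrow> real" where
  "beta \<zeta> k \<epsilon> = (if \<epsilon> = 0 then 1 else (LINT x|lborel. kern \<zeta> \<epsilon> x * cos (2 * k * x)))"

definition conv_rkern ::
  "(real \<Rightarrow> real) \<Rightarrow> real \<Rightarrow> real \<Rightarrow> (real \<Rightarrow> complex) \<Rightarrow> real \<Rightarrow> complex" where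
  "conv_rkern \<zeta> k \<epsilon> f x =
     (if \<epsilon> = 0 then f x else (LINT y|lborel. of_real (rkern \<zeta> k \<epsilon> (x - y)) * f y))"


section \<open>The standing wave and its linearization\<close>

text \<open>The potential is $V(x) = V_0 \sin^2(kx)$; it enters through \<open>V0\<close> only, since it cancels
  against the frequency and the density in the linearized operator.\<close>

definition amplitude :: "real \<Rightarrow> real \<Rightarrow> (real \<Rightarrow> real) \<Rightarrow> real \<Rightarrow> real \<Rightarrow> real" where
  "amplitude \<alpha> V0 \<zeta> k \<epsilon> = - V0 / (\<alpha> * beta \<zeta> k \<epsilon>)"

text \<open>Real and imaginary parts of $\phi_\omega(x/k)$, where
  $\phi_\omega(x) = \sqrt{B}\cos(kx) + i\sqrt{B+A}\sin(kx)$.\<close>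

definition u_omega :: "real \<Rightarrow> real \<Rightarrow> real" where
  "u_omega B x = sqrt B * cos x"

definition v_omega :: "real \<Rightarrow> real \<Rightarrow> real \<Rightarrow> real" where
  "v_omega A B x = sqrt (B + A) * sin x"

text \<open>The linearization for \<open>\<alpha> = 1\<close>, acting on functions of the rescaled variable.\<close>

definition L_op ::
  "(real \<Rightarrow> real) \<Rightarrow> real \<Rightarrow> real \<Rightarrow> real \<Rightarrow> real \<Rightarrow> real \<Rightarrow> cfun2 \<Rightarrow> cfun2" where
  "L_op \<zeta> k \<epsilon> A B T = (\<lambda>(w, z).
     let q = conv_rkern \<zeta> k \<epsilon> (\<lambda>x. of_real (u_omega B x) * w x + of_real (v_omega A B x) * z x)
     in (\<lambda>x. - of_real (k\<^sup>2 / 2) * (wderiv T (wderiv T w) x + w x) + 2 * of_real (u_omega B x) * q x,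
         \<lambda>x. - of_real (k\<^sup>2 / 2) * (wderiv T (wderiv T z) x + z x) + 2 * of_real (v_omega A B x) * q x))"

definition J_op :: "cfun2 \<Rightarrow> cfun2" where
  "J_op = (\<lambda>(f, g). (g, \<lambda>x. - f x))"

definition sigma_JL ::
  "(real \<Rightarrow> real) \<Rightarrow> real \<Rightarrow> real \<Rightarrow> real \<Rightarrow> real \<Rightarrow> real \<Rightarrow> complex set" where
  "sigma_JL \<zeta> k \<epsilon> A B T =
     spectrum T (sobolev 2 T \<times> sobolev 2 T) (J_op \<circ> L_op \<zeta> k \<epsilon> A B T)"

end

theory Submission
  imports Defs "HOL-Complex_Analysis.Cauchy_Integral_Formula" "HOL-Real_Asymp.Real_Asymp"
begin

text \<open>
  A real \<open>\<mu>\<close> is an eigenvalue of \<open>JL\<close> iff \<open>L + \<mu>J\<close> has a kernel.  On the \<open>\<pi>\<close>-periodic real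
  functions, which lie in every \<open>L\<^sup>2(S\<^sub>T)\<close> with \<open>T = 2\<pi>n\<close>, the quadratic form of \<open>L\<close> is, for small \<open>B\<close>
  and \<open>\<epsilon>\<close>, negative on \<open>(1, 0)\<close> and, as \<open>A\<close> is large compared with \<open>k\<^sup>2\<close>, coercive on the complement of \<open>(1, 0)\<close>.
  Since \<open>J\<close> is skew, \<open>L + \<mu>J\<close> is coercive there for every real \<open>\<mu>\<close>, so in each Galerkin truncation
  all equations but the one for \<open>(1, 0)\<close> can be solved with \<open>(1, 0)\<close>-coefficient 1.  The residual of
  the remaining equation is continuous in \<open>\<mu>\<close>, negative at 0 and positive for large \<open>\<mu>\<close>.  Its zeros
  stay in a compact subset of the positive reals independent of the truncation, and the modes at
  the cut-off are small because the form of \<open>L\<close> vanishes at the solution.  Hence a limit point of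
  the zeros admits approximate eigenvectors and lies in the spectrum.
\<close>

section \<open>A positive eigenvalue of a skew times a symmetric operator\<close>

text \<open>Even harmonics serve two purposes. They have period 2 pi n for every \<open>n\<close> at
  once, and they exclude the kernel that phase invariance gives \<open>L\<close>: the pair
  (-\<open>v_omega\<close>, \<open>u_omega\<close>) has frequency 1. \<open>L\<close> preserves them
  because the interaction multiplies twice by a cosine or a sine. On even modes the kinetic part is
  negative only on the two constants. On (1, 0) the interaction adds at most \<open>B\<close>, too
  little to change the sign; on (0, 1) it adds a multiple of \<open>B + A\<close>, which wins even
  after the coupling to neighbouring modes is paid for. \<open>J\<close> couples exactly these two
  constants, which is what turns a large \<mu> into a large solution. A limit of the truncated
  eigenvectors would require a compactness argument. It is avoided because the resolvent set demands
  a bounded inverse, and trigonometric polynomials with residuals small relative to their norms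
  already contradict that. The price is that all bounds must be uniform in the cut-off. The second
  derivative in \<open>L_op\<close> is a chosen weak derivative, so even on trigonometric
  polynomials it is known only almost everywhere, and only once weak derivatives are shown to be
  unique.\<close>

lemma coercive_system_solvable:
  fixes M :: "('i \<Rightarrow> real) \<Rightarrow> 'i \<Rightarrow> real"
  assumes fin: "finite S"
    and add: "\<And>x y. M (\<lambda>i. x i + y i) = (\<lambda>i. M x i + M y i)"
    and scale: "\<And>r x. M (\<lambda>i. r * x i) = (\<lambda>i. r * M x i)"
    and pos: "\<And>x. (\<And>i. i \<notin> S \<Longrightarrow> x i = 0) \<Longrightarrow> \<exists>i. x i \<noteq> 0 \<Longrightarrow> 0 < (\<Sum>i\<in>S. x i * M x i)"
  shows "\<exists>x. (\<forall>i. i \<notin> S \<longrightarrow> x i = 0) \<and> (\<forall>i\<in>S. M x i = b i)"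
  using fin pos
proof (induction S arbitrary: b rule: finite_induct)
  case empty
  then show ?case by auto
next
  case (insert k S)
  have pS: "0 < (\<Sum>i\<in>S. x i * M x i)" if "\<And>i. i \<notin> S \<Longrightarrow> x i = 0" "\<exists>i. x i \<noteq> 0" for x
  proof -
    have "0 < (\<Sum>i\<in>insert k S. x i * M x i)"
      by (rule insert.prems) (use that in auto)
    moreover have "x k = 0" using that(1) insert.hyps by auto
    ultimately show ?thesis using insert.hyps by simp
  qed
  define e where "e i = (if i = k then 1 else 0 :: real)" for i
  obtain x0 where x0: "\<And>i. i \<notin> S \<Longrightarrow> x0 i = 0" "\<And>i. i \<in> S \<Longrightarrow> M x0 i = b i"
    using insert.IH[OF pS, of b] by auto
  obtain x1 where x1: "\<And>i. i \<notin> S \<Longrightarrow> x1 i = 0" "\<And>i. i \<in> S \<Longrightarrow> M x1 i = - M e i"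
    using insert.IH[OF pS, of "\<lambda>i. - M e i"] by auto
  \<comment> \<open>Elimination of the index \<open>k\<close>: \<open>y\<close> is the unit vector
    \<open>e\<close> corrected so that all rows in \<open>S\<close> vanish. The form at
    \<open>y\<close> then reduces to the single entry \<open>M y k\<close>, which is therefore a
    positive pivot.\<close>
  define y where "y = (\<lambda>i. x1 i + e i)"
  have My: "M y i = M x1 i + M e i" for i unfolding y_def add ..
  have yS: "M y i = 0" if "i \<in> S" for i using x1(2)[OF that] My by simp
  have yk: "y k = 1" using x1(1) insert.hyps by (simp add: y_def e_def)
  have "0 < (\<Sum>i\<in>insert k S. y i * M y i)"
    by (rule insert.prems) (use x1 yk in \<open>auto simp: y_def e_def intro!: exI[of _ k]\<close>)
  also have "\<dots> = M y k" using insert.hyps yS yk by simp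
  finally have pk: "M y k > 0" .
  define t where "t = (b k - M x0 k) / M y k"
  have Mx: "M (\<lambda>i. x0 i + t * y i) i = M x0 i + t * M y i" for i
    using add[of x0 "\<lambda>i. t * y i"] scale[of t y] by (simp add: fun_eq_iff)
  show ?case
  proof (intro exI conjI allI ballI impI)
    fix i assume "i \<notin> insert k S"
    then show "x0 i + t * y i = 0" using x0(1) x1(1) by (auto simp: y_def e_def)
  next
    fix i assume "i \<in> insert k S"
    then show "M (\<lambda>i. x0 i + t * y i) i = b i"
      unfolding Mx using x0(2) yS pk insert.hyps by (auto simp: t_def)
  qed
qed

text \<open>The upper bound on the eigenvalue depends on the dimension only through the norms of the
  two rows \<open>i0\<close> and \<open>i1\<close>, which \<open>K\<close> couples.\<close>

lemma real_eigenvalue_of_skew_times_symmetric: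
  fixes L K :: "('i \<Rightarrow> real) \<Rightarrow> 'i \<Rightarrow> real" and I :: "'i set" and i0 i1 :: 'i
  defines "e \<equiv> \<lambda>i. if i = i0 then 1 else 0 :: real"
  assumes fin: "finite I" and i01: "i0 \<in> I" "i1 \<in> I" "i0 \<noteq> i1"
    and L_add: "\<And>x y. L (\<lambda>i. x i + y i) = (\<lambda>i. L x i + L y i)"
    and L_scale: "\<And>r x. L (\<lambda>i. r * x i) = (\<lambda>i. r * L x i)"
    and K_add: "\<And>x y. K (\<lambda>i. x i + y i) = (\<lambda>i. K x i + K y i)"
    and K_scale: "\<And>r x. K (\<lambda>i. r * x i) = (\<lambda>i. r * K x i)"
    and sym: "\<And>x y. (\<And>i. i \<notin> I \<Longrightarrow> x i = 0) \<Longrightarrow> (\<And>i. i \<notin> I \<Longrightarrow> y i = 0) \<Longrightarrow>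
        (\<Sum>i\<in>I. x i * L y i) = (\<Sum>i\<in>I. y i * L x i)"
    and skew: "\<And>x. (\<Sum>i\<in>I. x i * K x i) = 0"
    and K0: "\<And>x. K x i0 = x i1" and K1: "\<And>x. K x i1 = - x i0"
    and coercive: "\<And>x. (\<And>i. i \<notin> I \<Longrightarrow> x i = 0) \<Longrightarrow> x i0 = 0 \<Longrightarrow>
        c * (\<Sum>i\<in>I. (x i)\<^sup>2) \<le> (\<Sum>i\<in>I. x i * L x i)"
    and neg: "L e i0 = - a" and pos: "0 < c" "0 < a" "0 < R"
    and rows: "\<And>x. (\<And>i. i \<notin> I \<Longrightarrow> x i = 0) \<Longrightarrow> \<bar>L x i0\<bar> \<le> R * L2_set x I"
              "\<And>x. (\<And>i. i \<notin> I \<Longrightarrow> x i = 0) \<Longrightarrow> \<bar>L x i1\<bar> \<le> R * L2_set x I"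
  shows "\<exists>lam x. sqrt (c * a) \<le> lam \<and> lam \<le> R * (2 + (2 * R + a) / c) \<and>
      (\<forall>i. i \<notin> I \<longrightarrow> x i = 0) \<and> x i0 = 1 \<and> (\<forall>i\<in>I. L x i + lam * K x i = 0)"
proof -
  define I' where "I' = I - {i0}"
  have finI': "finite I'" and II: "I = insert i0 I'" "i0 \<notin> I'" "i1 \<in> I'"
    using fin i01 by (auto simp: I'_def)
  define Q where "Q x = (\<Sum>i\<in>I. x i * L x i)" for x
  have sumI': "(\<Sum>i\<in>I. x i * g i) = (\<Sum>i\<in>I'. x i * g i)" if "x i0 = 0" for x g :: "'i \<Rightarrow> real"
    unfolding II(1) using finI' II(2) that by simp
  have sq: "(\<Sum>i\<in>I. (x i)\<^sup>2) = (L2_set x I)\<^sup>2" for x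
    unfolding L2_set_def by (simp add: sum_nonneg)
  have coer: "c * (L2_set x I)\<^sup>2 \<le> Q x" if "\<And>i. i \<notin> I' \<Longrightarrow> x i = 0" for x
    using coercive[of x] that II unfolding Q_def sq by auto
  have normpos: "0 < L2_set x I" if "\<And>i. i \<notin> I' \<Longrightarrow> x i = 0" "\<exists>i. x i \<noteq> 0" for x
  proof -
    have "L2_set x I \<noteq> 0" using that L2_set_eq_0_iff[OF fin, of x] II(1) by auto
    then show ?thesis using L2_set_nonneg[of x I] by linarith
  qed
  have "\<exists>y. (\<forall>i. i \<notin> I' \<longrightarrow> y i = 0) \<and> (\<forall>i\<in>I'. L y i + lam * K y i = - (L e i + lam * K e i))" for lam
  proof (rule coercive_system_solvable[OF finI', of "\<lambda>x i. L x i + lam * K x i" "\<lambda>i. - (L e i + lam * K e i)"])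
    fix x :: "'i \<Rightarrow> real" assume x: "\<And>i. i \<notin> I' \<Longrightarrow> x i = 0" "\<exists>i. x i \<noteq> 0"
    have "(\<Sum>i\<in>I'. x i * (L x i + lam * K x i)) = (\<Sum>i\<in>I. x i * (L x i + lam * K x i))"
      using sumI' x II by simp
    also have "\<dots> = Q x + lam * (\<Sum>i\<in>I. x i * K x i)"
      unfolding Q_def sum_distrib_left sum.distrib[symmetric] by (simp add: algebra_simps)
    also have "\<dots> = Q x" using skew by simp
    finally have "(\<Sum>i\<in>I'. x i * (L x i + lam * K x i)) = Q x" .
    moreover have "0 < c * (L2_set x I)\<^sup>2" using normpos[OF x] pos by simp
    ultimately show "0 < (\<Sum>i\<in>I'. x i * (L x i + lam * K x i))" using coer[of x] x by simp
  qed (simp_all add: L_add L_scale K_add K_scale algebra_simps)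
  then obtain Y where Y0: "\<And>lam i. i \<notin> I' \<Longrightarrow> Y lam i = 0"
    and Y: "\<And>lam i. i \<in> I' \<Longrightarrow> L (Y lam) i + lam * K (Y lam) i = - (L e i + lam * K e i)"
    by metis
  define f where "f lam i = e i + Y lam i" for lam i
  have Lf: "L (f lam) i = L e i + L (Y lam) i" and Kf: "K (f lam) i = K e i + K (Y lam) i" for lam i
    unfolding f_def L_add K_add by auto
  have f_row: "L (f lam) i + lam * K (f lam) i = 0" if "i \<in> I'" for lam i
    using Y[OF that, of lam] unfolding Lf Kf by (simp add: algebra_simps)
  have f_supp: "f lam i = 0" if "i \<notin> I" for lam i
    using that Y0 II(1) by (auto simp: f_def e_def)
  have f0: "f lam i0 = 1" for lam using Y0 II by (simp add: f_def e_def)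
  have f1: "f lam i1 = Y lam i1" for lam using i01 by (simp add: f_def e_def)
  define mu where "mu lam = L (f lam) i0 + lam * K (f lam) i0" for lam
  have mu_alt: "mu lam = - a + L (Y lam) i0 + lam * Y lam i1" for lam
    unfolding mu_def Lf K0 f1 neg by simp
  \<comment> \<open>Pairing all rows with \<open>f lam\<close> leaves only the residual, since the
    other rows vanish and the \<open>i0\<close> entry is 1; skewness removes \<open>K\<close>.
    Comparing this with \<open>mu_alt\<close> drives every sign argument below.\<close>
  have mu_Q: "mu lam = Q (f lam)" for lam
  proof -
    have "(\<Sum>i\<in>I. f lam i * (L (f lam) i + lam * K (f lam) i)) = mu lam"
      unfolding II(1) using finI' II(2) f_row f0 by (simp add: mu_def)
    moreover have "(\<Sum>i\<in>I. f lam i * (L (f lam) i + lam * K (f lam) i)) = 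
        Q (f lam) + lam * (\<Sum>i\<in>I. f lam i * K (f lam) i)"
      unfolding Q_def sum_distrib_left sum.distrib[symmetric] by (simp add: algebra_simps)
    ultimately show ?thesis using skew by simp
  qed
  have e_sum: "(\<Sum>i\<in>I. e i * g i) = g i0" for g :: "'i \<Rightarrow> real"
    unfolding e_def using fin i01 by (simp add: if_distrib[of "\<lambda>u. u * _"] cong: if_cong)
  have Qf: "Q (f lam) = - a + 2 * L (Y lam) i0 + Q (Y lam)" for lam
  proof -
    have "Q (f lam) = (\<Sum>i\<in>I. e i * L e i) + (\<Sum>i\<in>I. e i * L (Y lam) i) +
        (\<Sum>i\<in>I. Y lam i * L e i) + Q (Y lam)"
      unfolding Q_def Lf sum.distrib[symmetric] by (simp add: f_def algebra_simps)
    moreover have "(\<Sum>i\<in>I. Y lam i * L e i) = (\<Sum>i\<in>I. e i * L (Y lam) i)"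
      by (rule sym) (use Y0 II in \<open>auto simp: e_def\<close>)
    ultimately show ?thesis unfolding e_sum using neg by simp
  qed
  have L_Y: "\<bar>L (Y lam) i0\<bar> \<le> R * L2_set (Y lam) I" for lam
    by (rule rows) (use Y0 II in auto)
  have Q_Y: "c * (L2_set (Y lam) I)\<^sup>2 \<le> Q (Y lam)" for lam
    by (rule coer) (rule Y0)
  \<comment> \<open>At 0 the two expressions for \<open>mu\<close> force
    \<open>L (Y 0) i0 = - Q (Y 0)\<close>, so the value is \<open>- a - Q (Y 0)\<close>.\<close>
  have mu0: "mu 0 < 0"
  proof -
    have "mu 0 = - a + L (Y 0) i0" by (simp add: mu_alt)
    moreover have "mu 0 = - a + 2 * L (Y 0) i0 + Q (Y 0)" by (simp add: mu_Q Qf)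
    moreover have "0 \<le> Q (Y 0)" using Q_Y[of 0] pos(1)
      by (meson order_trans mult_nonneg_nonneg less_imp_le zero_le_power2)
    ultimately show ?thesis using pos by linarith
  qed
  define Lam where "Lam = R * (2 + (2 * R + a) / c)"
  have Lam0: "0 \<le> Lam" unfolding Lam_def using pos by simp
  \<comment> \<open>Row \<open>i1\<close> reads \<open>L (f Lam) i1 = Lam\<close>, because
    \<open>K\<close> maps the normalized entry 1 to -1 there. Hence a large parameter forces a large
    \<open>Y Lam\<close>, and in the form the quadratic term \<open>c * r\<^sup>2\<close> beats the
    linear cross term \<open>2 * R * r\<close>. \<open>Lam\<close> is chosen so that r is at least 1
    + (2 R + a) / c.\<close>
  have muLam: "0 < mu Lam"
  proof -
    define r where "r = L2_set (Y Lam) I"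
    have "L (f Lam) i1 = Lam" using f_row[OF II(3), of Lam] unfolding K1 f0 by simp
    moreover have "\<bar>L (f Lam) i1\<bar> \<le> R * L2_set (f Lam) I" by (rule rows) (rule f_supp)
    moreover have "L2_set (f Lam) I \<le> L2_set e I + r"
      unfolding r_def f_def by (rule L2_set_triangle_ineq)
    moreover have "L2_set e I = 1"
      unfolding L2_set_def e_def power2_eq_square using e_sum[of e] by (simp add: e_def)
    ultimately have "Lam \<le> R * (1 + r)"
      by (smt (verit, best) pos(3) mult_le_cancel_left_pos)
    then have r: "1 + (2 * R + a) / c \<le> r" unfolding Lam_def using pos(3) by simp
    then have "c + (2 * R + a) \<le> c * r" using pos(1) by (simp add: field_simps)
    moreover have r1: "1 \<le> r" using r pos by (smt (verit) divide_nonneg_pos)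
    ultimately have "c + a \<le> r * (c * r - 2 * R)"
      using pos by (smt (verit) mult_less_cancel_right2 mult_le_cancel_right1)
    then have "a < c * r\<^sup>2 - 2 * R * r" using pos by (simp add: algebra_simps power2_eq_square)
    then show ?thesis using L_Y[of Lam] Q_Y[of Lam] unfolding mu_Q Qf r_def[symmetric] by linarith
  qed
  \<comment> \<open>The difference \<open>d\<close> of two solutions solves the same reduced system
    with right-hand side \<open>- (l - l0) * K (f l0)\<close>. Testing with \<open>d\<close> removes
    \<open>K\<close>, and coercivity bounds \<open>d\<close>; the constant depends on
    \<open>l0\<close> only.\<close>
  have Y_lip: "L2_set (\<lambda>i. Y l i - Y l0 i) I \<le> \<bar>l - l0\<bar> * (L2_set (K (f l0)) I / c)" for l l0
  proof -
    define d where "d = (\<lambda>i. Y l i - Y l0 i)"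
    have d0: "d i = 0" if "i \<notin> I'" for i using that Y0 by (simp add: d_def)
    have Yl: "Y l = (\<lambda>i. Y l0 i + d i)" by (auto simp: d_def)
    have Lfl: "L (f l) i = L (f l0) i + L d i" and Kfl: "K (f l) i = K (f l0) i + K d i" for i
      unfolding Lf Kf Yl L_add K_add by auto
    have row: "L d i + l * K d i = - ((l - l0) * K (f l0) i)" if "i \<in> I'" for i
      using f_row[OF that, of l] f_row[OF that, of l0] unfolding Lfl Kfl by (simp add: algebra_simps)
    have "Q d = (\<Sum>i\<in>I. d i * (L d i + l * K d i))"
      using skew[of d] unfolding Q_def by (simp add: algebra_simps sum.distrib sum_distrib_left[symmetric])
    also have "\<dots> = (\<Sum>i\<in>I. d i * (- ((l - l0) * K (f l0) i)))"
      unfolding sumI'[of d, OF d0[OF II(2)]] by (intro sum.cong refl) (simp only: row)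
    also have "\<dots> = - (l - l0) * (\<Sum>i\<in>I. d i * K (f l0) i)"
      unfolding sum_distrib_left by (simp add: algebra_simps)
    also have "\<dots> \<le> \<bar>l - l0\<bar> * (L2_set d I * L2_set (K (f l0)) I)"
    proof -
      have "\<bar>\<Sum>i\<in>I. d i * K (f l0) i\<bar> \<le> (\<Sum>i\<in>I. \<bar>d i\<bar> * \<bar>K (f l0) i\<bar>)"
        using sum_abs[of "\<lambda>i. d i * K (f l0) i" I] by (simp add: abs_mult)
      also have "\<dots> \<le> L2_set d I * L2_set (K (f l0)) I" by (rule L2_set_mult_ineq)
      finally have "\<bar>l - l0\<bar> * \<bar>\<Sum>i\<in>I. d i * K (f l0) i\<bar> \<le> \<bar>l - l0\<bar> * (L2_set d I * L2_set (K (f l0)) I)"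
        by (rule mult_left_mono) simp
      then show ?thesis using abs_ge_self[of "- (l - l0) * (\<Sum>i\<in>I. d i * K (f l0) i)"]
        by (simp add: abs_mult abs_minus_commute)
    qed
    finally have "c * (L2_set d I)\<^sup>2 \<le> \<bar>l - l0\<bar> * (L2_set d I * L2_set (K (f l0)) I)"
      using coer[of d] d0 by force
    then have "L2_set d I * (c * L2_set d I) \<le> L2_set d I * (\<bar>l - l0\<bar> * L2_set (K (f l0)) I)"
      by (simp add: power2_eq_square algebra_simps)
    then have "c * L2_set d I \<le> \<bar>l - l0\<bar> * L2_set (K (f l0)) I"
      using L2_set_nonneg[of d I] L2_set_nonneg[of "K (f l0)" I]
      by (cases "L2_set d I = 0") (auto simp: mult_le_cancel_left)
    then show ?thesis using pos(1) unfolding d_def by (simp add: pos_le_divide_eq mult.commute)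
  qed
  have Y_lim: "((\<lambda>l. L2_set (\<lambda>i. Y l i - Y l0 i) I) \<longlongrightarrow> 0) (at l0)" for l0
  proof (rule tendsto_sandwich[of "\<lambda>_. 0" _ _ "\<lambda>l. \<bar>l - l0\<bar> * (L2_set (K (f l0)) I / c)"])
    show "((\<lambda>l. \<bar>l - l0\<bar> * (L2_set (K (f l0)) I / c)) \<longlongrightarrow> 0) (at l0)"
      using pos(1) by (auto intro!: tendsto_eq_intros)
  qed (use Y_lip in auto)
  have "isCont mu l0" for l0
  proof -
    have "((\<lambda>l. Y l i1 - Y l0 i1) \<longlongrightarrow> 0) (at l0)"
    proof (rule Lim_null_comparison[OF always_eventually Y_lim], rule allI)
      fix l
      have "\<bar>Y l i1 - Y l0 i1\<bar> \<le> L2_set (\<lambda>i. Y l i - Y l0 i) I"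
        using member_le_L2_set[OF fin i01(2), of "\<lambda>i. \<bar>Y l i - Y l0 i\<bar>"]
        by (simp add: L2_set_def)
      then show "norm (Y l i1 - Y l0 i1) \<le> L2_set (\<lambda>i. Y l i - Y l0 i) I" by simp
    qed
    then have 1: "((\<lambda>l. Y l i1) \<longlongrightarrow> Y l0 i1) (at l0)" by (simp add: LIM_zero_iff)
    have "((\<lambda>l. L (Y l) i0 - L (Y l0) i0) \<longlongrightarrow> 0) (at l0)"
    proof (rule Lim_null_comparison[OF always_eventually], rule allI)
      fix l
      have "L (Y l) i0 - L (Y l0) i0 = L (\<lambda>i. Y l i - Y l0 i) i0"
        using L_add[of "\<lambda>i. Y l i - Y l0 i" "Y l0"] by (simp add: fun_eq_iff)
      moreover have "\<bar>L (\<lambda>i. Y l i - Y l0 i) i0\<bar> \<le> R * L2_set (\<lambda>i. Y l i - Y l0 i) I"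
        by (rule rows) (use Y0 II in auto)
      ultimately show "norm (L (Y l) i0 - L (Y l0) i0) \<le> R * L2_set (\<lambda>i. Y l i - Y l0 i) I"
        by simp
      show "((\<lambda>l. R * L2_set (\<lambda>i. Y l i - Y l0 i) I) \<longlongrightarrow> 0) (at l0)"
        using tendsto_mult_left[OF Y_lim, of R l0] by simp
    qed
    then have 2: "((\<lambda>l. L (Y l) i0) \<longlongrightarrow> L (Y l0) i0) (at l0)" by (simp add: LIM_zero_iff)
    show ?thesis unfolding isCont_def mu_alt by (intro tendsto_intros 1 2)
  qed
  then have "\<exists>lam. 0 \<le> lam \<and> lam \<le> Lam \<and> mu lam = 0"
    using IVT[of mu 0 0 Lam] mu0 muLam Lam0 by auto
  then obtain lam where lam: "0 \<le> lam" "lam \<le> Lam" "mu lam = 0" by auto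
  \<comment> \<open>Eliminating \<open>L (Y lam) i0\<close> from the two expressions for the
    vanishing residual leaves \<open>a + Q (Y lam) = 2 * (lam * Y lam i1)\<close>. Coercivity on the
    left and the inequality of arithmetic and geometric means give the bound.\<close>
  have "sqrt (c * a) \<le> lam"
  proof -
    define r where "r = L2_set (Y lam) I"
    have r0: "0 \<le> r" by (simp add: r_def)
    have "a + Q (Y lam) = 2 * (lam * Y lam i1)"
      using lam(3) mu_alt[of lam] mu_Q[of lam] Qf[of lam] by simp
    moreover have "\<bar>Y lam i1\<bar> \<le> r"
      using member_le_L2_set[OF fin i01(2), of "\<lambda>i. \<bar>Y lam i\<bar>"] by (simp add: L2_set_def r_def)
    then have "lam * Y lam i1 \<le> lam * r" using lam(1) by (intro mult_left_mono) auto
    ultimately have "a + c * r\<^sup>2 \<le> 2 * (lam * r)"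
      using Q_Y[of lam] unfolding r_def[symmetric] by linarith
    moreover have "0 \<le> (sqrt a - sqrt c * r)\<^sup>2" by simp
    moreover have "(sqrt a - sqrt c * r)\<^sup>2 = a + c * r\<^sup>2 - 2 * (sqrt (c * a) * r)"
      using pos by (simp add: power2_diff power_mult_distrib real_sqrt_mult)
    ultimately have "sqrt (c * a) * r \<le> lam * r" "r \<noteq> 0" using pos by auto
    then show ?thesis using r0 by simp
  qed
  moreover have "\<forall>i\<in>I. L (f lam) i + lam * K (f lam) i = 0"
    using f_row lam(3) unfolding II(1) mu_def by auto
  ultimately show ?thesis using lam(2) f_supp f0 unfolding Lam_def by blast
qed

section \<open>The linearized operator on Fourier coefficients\<close>

text \<open>Shifting or reflecting indices moves the ends of a summation range. Covering the support
  is enough, so both ranges can be kept in symmetric form.\<close>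

lemma sum_reindex_support:
  fixes g :: "'a \<Rightarrow> 'b::comm_monoid_add"
  assumes "bij h" "finite S" "finite S'" "\<And>i. i \<notin> S \<Longrightarrow> g i = 0" "\<And>i. i \<notin> S' \<Longrightarrow> g (h i) = 0"
  shows "(\<Sum>i\<in>S'. g (h i)) = (\<Sum>i\<in>S. g i)"
proof -
  have "(\<Sum>i\<in>S'. g (h i)) = (\<Sum>i\<in>h ` S'. g i)"
    using assms(1) by (subst sum.reindex) (auto simp: bij_def inj_on_def)
  also have "\<dots> = (\<Sum>i\<in>S. g i)"
  proof (rule sum.mono_neutral_cong)
    fix i assume "i \<in> S - h ` S'"
    then have "inv h i \<notin> S'" using assms(1) by (metis DiffE bij_inv_eq_iff image_eqI)
    then show "g i = 0" using assms(5)[of "inv h i"] assms(1) by (simp add: bij_is_surj surj_f_inv_f)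
  qed (use assms in auto)
  finally show ?thesis .
qed

lemma bij_int_shift: "bij (\<lambda>m::int. m + a)" and bij_int_flip: "bij (\<lambda>m::int. a - m)"
  by (rule o_bij[of "\<lambda>m. m - a"]; force) (rule o_bij[of "\<lambda>m. a - m"]; force)

text \<open>The pair \<open>(w, z)\<close> is expanded in the real orthogonal system \<open>cas (2 m t)\<close> with
  \<open>cas t = cos t + sin t\<close> and \<open>m\<close> an integer; \<open>x (Inl m)\<close> and \<open>x (Inr m)\<close> are the coefficients of \<open>w\<close>
  and \<open>z\<close>, and \<open>q_coeff p s x j\<close> is the coefficient of \<open>cas ((2 j + 1) t)\<close> in \<open>p cos t w + s sin t z\<close>.
  Multiplication by \<open>sin t\<close> reverses the sign of the frequency.  The weight \<open>\<rho> j\<close> is the Fourier multiplier of the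
  convolution and \<open>\<kappa>\<close> is \<open>k\<^sup>2 / 2\<close>.\<close>

definition q_coeff :: "real \<Rightarrow> real \<Rightarrow> (int + int \<Rightarrow> real) \<Rightarrow> int \<Rightarrow> real" where
  "q_coeff p s x j = p / 2 * (x (Inl j) + x (Inl (j + 1))) + s / 2 * (x (Inr (- j)) - x (Inr (- j - 1)))"

definition L_coeff :: "real \<Rightarrow> real \<Rightarrow> real \<Rightarrow> (int \<Rightarrow> real) \<Rightarrow> (int + int \<Rightarrow> real) \<Rightarrow> int + int \<Rightarrow> real" where
  "L_coeff \<kappa> p s \<rho> x i = (case i of
     Inl m \<Rightarrow> \<kappa> * (4 * (of_int m)\<^sup>2 - 1) * x i +
       p * (\<rho> (m - 1) * q_coeff p s x (m - 1) + \<rho> m * q_coeff p s x m)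
   | Inr m \<Rightarrow> \<kappa> * (4 * (of_int m)\<^sup>2 - 1) * x i +
       s * (\<rho> (- m) * q_coeff p s x (- m) - \<rho> (- m - 1) * q_coeff p s x (- m - 1)))"

definition J_coeff :: "(int + int \<Rightarrow> real) \<Rightarrow> int + int \<Rightarrow> real" where
  "J_coeff x i = (case i of Inl m \<Rightarrow> x (Inr m) | Inr m \<Rightarrow> - x (Inl m))"

abbreviation modes :: "int \<Rightarrow> (int + int) set" where
  "modes N \<equiv> {- N..N} <+> {- N..N}"

lemma modes_iff: "Inl m \<in> modes N \<longleftrightarrow> m \<in> {- N..N}" "Inr m \<in> modes N \<longleftrightarrow> m \<in> {- N..N}"
  by auto

lemma sum_modes: "(\<Sum>i\<in>modes N. g i) = (\<Sum>m\<in>{- N..N}. g (Inl m) + g (Inr m))"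
  for g :: "int + int \<Rightarrow> real"
  by (simp add: sum.Plus sum.distrib)

lemma q_coeff_add: "q_coeff p s (\<lambda>i. x i + y i) j = q_coeff p s x j + q_coeff p s y j"
  and q_coeff_scale: "q_coeff p s (\<lambda>i. r * x i) j = r * q_coeff p s x j"
  by (simp_all add: q_coeff_def field_simps)

lemma L_coeff_add: "L_coeff \<kappa> p s \<rho> (\<lambda>i. x i + y i) = (\<lambda>i. L_coeff \<kappa> p s \<rho> x i + L_coeff \<kappa> p s \<rho> y i)"
  by (rule ext) (simp add: L_coeff_def q_coeff_add algebra_simps split: sum.split)

lemma L_coeff_scale: "L_coeff \<kappa> p s \<rho> (\<lambda>i. r * x i) = (\<lambda>i. r * L_coeff \<kappa> p s \<rho> x i)"
  by (rule ext) (simp add: L_coeff_def q_coeff_scale algebra_simps split: sum.split)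

text \<open>The interaction is twice the adjoint of \<open>q_coeff\<close>, weighted by \<rho>,
  composed with \<open>q_coeff\<close>: the coupling terms of \<open>L_coeff\<close> are that
  adjoint written out. This makes the symmetry visible and shows that nonnegative weights never
  lower the form. Modes up to \<open>N\<close> reach only the indices \<open>j\<close> from -N - 1
  to N.\<close>

lemma L_coeff_form:
  assumes x: "\<forall>i. i \<notin> modes N \<longrightarrow> x i = 0"
  shows "(\<Sum>i\<in>modes N. x i * L_coeff \<kappa> p s \<rho> y i) =
     (\<Sum>m\<in>{- N..N}. \<kappa> * (4 * (of_int m)\<^sup>2 - 1) * (x (Inl m) * y (Inl m) + x (Inr m) * y (Inr m))) +
     2 * (\<Sum>j\<in>{- N - 1..N}. \<rho> j * (q_coeff p s x j * q_coeff p s y j))"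
proof -
  let ?Q = "\<lambda>j. \<rho> j * q_coeff p s y j"
  have xl: "x (Inl m) = 0" and xr: "x (Inr m) = 0" if "m \<notin> {- N..N}" for m
    using x that modes_iff[of m N] by blast+
  have 1: "(\<Sum>m\<in>{- N..N}. x (Inl m) * ?Q (m - 1)) = (\<Sum>j\<in>{- N - 1..N}. x (Inl (j + 1)) * ?Q j)"
    by (rule trans[OF sum_reindex_support[OF bij_int_shift[of 1], of "{- N..N}" "{- N - 1..N}"
      "\<lambda>m. x (Inl m) * ?Q (m - 1)", symmetric]]) (use xl in auto)
  have 2: "(\<Sum>m\<in>{- N..N}. x (Inl m) * ?Q m) = (\<Sum>j\<in>{- N - 1..N}. x (Inl j) * ?Q j)"
    by (rule sum.mono_neutral_left) (use xl in auto)
  have 3: "(\<Sum>m\<in>{- N..N}. x (Inr m) * ?Q (- m)) = (\<Sum>j\<in>{- N - 1..N}. x (Inr (- j)) * ?Q j)"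
    by (rule trans[OF sum_reindex_support[OF bij_int_flip[of 0], of "{- N - 1..N}" "{- N..N}"
      "\<lambda>j. x (Inr (- j)) * ?Q j", symmetric], symmetric]) (use xr in auto)
  have flip: "- m - 1 = - 1 - m" for m :: int by simp
  have 4: "(\<Sum>m\<in>{- N..N}. x (Inr m) * ?Q (- m - 1)) = (\<Sum>j\<in>{- N - 1..N}. x (Inr (- j - 1)) * ?Q j)"
    by (rule trans[OF sum_reindex_support[OF bij_int_flip[of "- 1"], of "{- N - 1..N}" "{- N..N}"
      "\<lambda>j. x (Inr (- j - 1)) * ?Q j", symmetric], symmetric]) (use xr in \<open>auto simp: flip\<close>)
  have "(\<Sum>i\<in>modes N. x i * L_coeff \<kappa> p s \<rho> y i) =
     (\<Sum>m\<in>{- N..N}. \<kappa> * (4 * (of_int m)\<^sup>2 - 1) * (x (Inl m) * y (Inl m) + x (Inr m) * y (Inr m))) +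
     (p * (\<Sum>m\<in>{- N..N}. x (Inl m) * ?Q (m - 1)) + p * (\<Sum>m\<in>{- N..N}. x (Inl m) * ?Q m) +
      (s * (\<Sum>m\<in>{- N..N}. x (Inr m) * ?Q (- m)) - s * (\<Sum>m\<in>{- N..N}. x (Inr m) * ?Q (- m - 1))))"
    unfolding sum_modes sum_distrib_left sum.distrib[symmetric] sum_subtractf[symmetric]
    by (rule sum.cong) (auto simp: L_coeff_def algebra_simps)
  also have "p * (\<Sum>m\<in>{- N..N}. x (Inl m) * ?Q (m - 1)) + p * (\<Sum>m\<in>{- N..N}. x (Inl m) * ?Q m) +
      (s * (\<Sum>m\<in>{- N..N}. x (Inr m) * ?Q (- m)) - s * (\<Sum>m\<in>{- N..N}. x (Inr m) * ?Q (- m - 1)))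
     = 2 * (\<Sum>j\<in>{- N - 1..N}. \<rho> j * (q_coeff p s x j * q_coeff p s y j))"
    unfolding 1 2 3 4 sum_distrib_left sum.distrib[symmetric] sum_subtractf[symmetric]
    by (rule sum.cong) (auto simp: q_coeff_def[of p s x] field_simps)
  finally show ?thesis .
qed

section \<open>Coercivity away from the constant pair (1, 0)\<close>

lemma low_mode_bound:
  fixes \<kappa> p s r w z y :: real
  assumes "0 < \<kappa>" "p\<^sup>2 \<le> \<kappa>" "4.92 * \<kappa> \<le> s\<^sup>2" "0.9 \<le> r"
  shows "0.6 * (\<kappa> * z\<^sup>2) \<le> 2 * (r * (p / 2 * w + s / 2 * (z - y))\<^sup>2) + 2.8 * (\<kappa> * w\<^sup>2 + \<kappa> * y\<^sup>2)"
proof -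
  let ?q = "p / 2 * w + s / 2 * (z - y)"
  \<comment> \<open>With u = p w / 2 and v = s (z - y) / 2 this is
    \<open>(u + v)\<^sup>2 \<ge> v\<^sup>2 / 2 - u\<^sup>2\<close>; the defect is a square.\<close>
  have "s\<^sup>2 / 8 * (z - y)\<^sup>2 - p\<^sup>2 / 4 * w\<^sup>2 \<le> ?q\<^sup>2"
  proof -
    have "?q\<^sup>2 - (s\<^sup>2 / 8 * (z - y)\<^sup>2 - p\<^sup>2 / 4 * w\<^sup>2) = 2 * (p / 2 * w + s / 4 * (z - y))\<^sup>2"
      by (simp add: power2_eq_square field_simps)
    then show ?thesis by (smt (verit) zero_le_power2)
  qed
  moreover have "4.92 * \<kappa> * (z - y)\<^sup>2 \<le> s\<^sup>2 * (z - y)\<^sup>2" "p\<^sup>2 * w\<^sup>2 \<le> \<kappa> * w\<^sup>2"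
    using mult_right_mono[OF assms(3), of "(z - y)\<^sup>2"] mult_right_mono[OF assms(2), of "w\<^sup>2"] by auto
  moreover have "0.9 * ?q\<^sup>2 \<le> r * ?q\<^sup>2" by (rule mult_right_mono) (use assms in auto)
  \<comment> \<open>The constants are 1.107 = 2 * 0.9 * 4.92 / 8 and 0.45 = 2 * 0.9 / 4.\<close>
  ultimately have "1.107 * (\<kappa> * (z - y)\<^sup>2) - 0.45 * (\<kappa> * w\<^sup>2) \<le> 2 * (r * ?q\<^sup>2)" by simp
  moreover have "0 \<le> \<kappa> * w\<^sup>2" using assms by simp
  moreover have "0.6 * (\<kappa> * z\<^sup>2) \<le> 1.107 * (\<kappa> * (z - y)\<^sup>2) + 2.8 * (\<kappa> * y\<^sup>2)"
  proof -
    \<comment> \<open>Completing the square in \<open>z\<close>, with 0.507 = 1.107 - 0.6 and 3.907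
      = 1.107 + 2.8; the remaining coefficient of \<open>y\<^sup>2\<close> is positive.\<close>
    have "1.107 * (z - y)\<^sup>2 + 2.8 * y\<^sup>2 - 0.6 * z\<^sup>2 = 0.507 * (z - 1.107 / 0.507 * y)\<^sup>2 + (3.907 - 1.107\<^sup>2 / 0.507) * y\<^sup>2"
      by (simp add: power2_eq_square field_simps)
    also have "\<dots> \<ge> 0" by (simp add: power2_eq_square)
    finally have "\<kappa> * (0.6 * z\<^sup>2) \<le> \<kappa> * (1.107 * (z - y)\<^sup>2 + 2.8 * y\<^sup>2)" using assms(1) by simp
    then show ?thesis by (simp add: algebra_simps)
  qed
  moreover have "0.6 * Z \<le> 2 * P + 2.8 * (W + Y)"
    if "1.107 * D - 0.45 * W \<le> 2 * P" "0 \<le> W" "0.6 * Z \<le> 1.107 * D + 2.8 * Y" for P D W Y Z :: real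
    using that by (simp add: field_simps)
  ultimately show ?thesis by blast
qed

text \<open>The bound \<kappa> / 5 is split off the diagonal by writing 4 m^2 - 1 as (4 m^2 - 1.2) +
  0.2. The only negative entry left is -1.2 \<kappa> at \<open>Inr 0\<close>; half of it is paid by
  the interaction at \<open>j = 0\<close> and half at \<open>j = - 1\<close>, each time with the
  help of two of the four modes at m = 1 and m = -1, whose entries are 2.8 \<kappa>.\<close>

lemma L_coeff_coercive:
  fixes N :: int
  assumes N: "1 \<le> N" and "0 < \<kappa>" "p\<^sup>2 \<le> \<kappa>" "4.92 * \<kappa> \<le> s\<^sup>2"
    and \<rho>: "\<And>j. 0 \<le> \<rho> j" "0.9 \<le> \<rho> 0" "0.9 \<le> \<rho> (- 1)"
    and x: "\<And>i. i \<notin> modes N \<Longrightarrow> x i = 0" and x0: "x (Inl 0) = 0"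
  shows "\<kappa> / 5 * (\<Sum>i\<in>modes N. (x i)\<^sup>2) \<le> (\<Sum>i\<in>modes N. x i * L_coeff \<kappa> p s \<rho> x i)"
proof -
  let ?g = "\<lambda>m. \<kappa> * (4 * (of_int m)\<^sup>2 - 1.2) * ((x (Inl m))\<^sup>2 + (x (Inr m))\<^sup>2)"
  let ?q = "\<lambda>j. \<rho> j * (q_coeff p s x j * q_coeff p s x j)"
  have "(\<Sum>m\<in>{-1,0,1}. ?g m) \<le> (\<Sum>m\<in>{-N..N}. ?g m)"
  proof (rule sum_mono2)
    fix m assume "m \<in> {-N..N} - {-1,0,1}"
    then have "\<bar>m\<bar> \<ge> 1" by auto
    then have "1 \<le> \<bar>real_of_int m\<bar>" by linarith
    then have "1 \<le> (real_of_int m)\<^sup>2" using one_le_power[of "\<bar>real_of_int m\<bar>" 2] by simp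
    then show "0 \<le> ?g m" using \<open>0 < \<kappa>\<close> by (intro mult_nonneg_nonneg) auto
  qed (use N in auto)
  moreover have "(\<Sum>j\<in>{-1,0}. ?q j) \<le> (\<Sum>j\<in>{-N-1..N}. ?q j)"
    by (rule sum_mono2) (use N \<rho> in auto)
  \<comment> \<open>The two uses of \<open>low_mode_bound\<close> involve disjoint sets of
    neighbouring modes, so their sum spends each 2.8 \<kappa> once. At \<open>j = - 1\<close> the
    constant of \<open>z\<close> enters \<open>q_coeff\<close> with the opposite sign; replacing
    \<open>p\<close> by \<open>- p\<close> absorbs this, since only the square matters.\<close>
  moreover have "0 \<le> (\<Sum>m\<in>{-1,0,1}. ?g m) + 2 * (\<Sum>j\<in>{-1,0}. ?q j)"
    using low_mode_bound[OF assms(2-4) \<rho>(2), of "x (Inr 0)" "x (Inl 1)" "x (Inr (-1))"]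
      low_mode_bound[OF assms(2), of "- p" s "\<rho> (- 1)" "x (Inr 0)" "x (Inl (-1))" "x (Inr 1)"] assms(3,4) \<rho>(3)
    by (simp add: q_coeff_def x0 power2_eq_square algebra_simps)
  moreover have "(\<Sum>m\<in>{- N..N}. \<kappa> * (4 * (of_int m)\<^sup>2 - 1) * (x (Inl m) * x (Inl m) + x (Inr m) * x (Inr m)))
      = (\<Sum>m\<in>{-N..N}. ?g m) + \<kappa> / 5 * (\<Sum>i\<in>modes N. (x i)\<^sup>2)"
    unfolding sum_modes sum_distrib_left sum.distrib[symmetric]
    by (rule sum.cong) (simp_all add: power2_eq_square field_simps)
  moreover have "\<forall>i. i \<notin> modes N \<longrightarrow> x i = 0" using x by simp
  moreover note L_coeff_form[OF this, of \<kappa> p s \<rho> x]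
  ultimately show ?thesis by linarith
qed

text \<open>These are the two rows that \<open>J_coeff\<close> couples to each other and that bound
  the real eigenvalue from above. At m = 0 the diagonal is -\<kappa> and only \<open>q_coeff\<close>
  at -1 and 0 occurs, so the constant is free of the cut-off.\<close>

lemma L_coeff_row_bound:
  assumes "0 \<le> \<kappa>" "0 \<le> p" "0 \<le> s" and \<rho>: "\<And>j. 0 \<le> \<rho> j" "\<And>j. \<rho> j \<le> 1"
    and x: "\<And>i. \<bar>x i\<bar> \<le> n"
  shows "\<bar>L_coeff \<kappa> p s \<rho> x (Inl 0)\<bar> \<le> (\<kappa> + 2 * (p + s)\<^sup>2) * n"
    and "\<bar>L_coeff \<kappa> p s \<rho> x (Inr 0)\<bar> \<le> (\<kappa> + 2 * (p + s)\<^sup>2) * n"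
proof -
  have n0: "0 \<le> n" using x[of "Inl 0"] by linarith
  have q: "\<bar>\<rho> j * q_coeff p s x j\<bar> \<le> (p + s) * n" for j
  proof -
    have "\<bar>x (Inl j) + x (Inl (j + 1))\<bar> \<le> 2 * n" "\<bar>x (Inr (- j)) - x (Inr (- j - 1))\<bar> \<le> 2 * n"
      using x[of "Inl j"] x[of "Inl (j+1)"] x[of "Inr (-j)"] x[of "Inr (- j - 1)"] by linarith+
    then have "\<bar>p / 2 * (x (Inl j) + x (Inl (j + 1)))\<bar> \<le> p / 2 * (2 * n)"
       "\<bar>s / 2 * (x (Inr (- j)) - x (Inr (- j - 1)))\<bar> \<le> s / 2 * (2 * n)"
      using assms by (auto simp only: abs_mult abs_divide abs_of_nonneg abs_numeral intro!: mult_left_mono)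
    then have "\<bar>q_coeff p s x j\<bar> \<le> (p + s) * n" unfolding q_coeff_def by (simp add: algebra_simps)
    then show ?thesis using \<rho>[of j] assms n0 mult_mono[of "\<rho> j" 1 "\<bar>q_coeff p s x j\<bar>" "(p + s) * n"]
      by (simp add: abs_mult)
  qed
  have gen: "\<bar>- \<kappa> * a + t * b\<bar> \<le> (\<kappa> + 2 * (p + s)\<^sup>2) * n"
    if "\<bar>a\<bar> \<le> n" "0 \<le> t" "t \<le> p + s" "\<bar>b\<bar> \<le> 2 * ((p + s) * n)" for a b t
  proof -
    have "\<bar>\<kappa> * a\<bar> \<le> \<kappa> * n" using that assms by (simp add: abs_mult mult_left_mono)
    moreover have "\<bar>t * b\<bar> \<le> (p + s) * (2 * ((p + s) * n))"
      unfolding abs_mult by (rule mult_mono) (use that assms in auto)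
    ultimately show ?thesis by (simp add: power2_eq_square algebra_simps)
  qed
  show "\<bar>L_coeff \<kappa> p s \<rho> x (Inl 0)\<bar> \<le> (\<kappa> + 2 * (p + s)\<^sup>2) * n"
    using gen[OF x[of "Inl 0"], of p "\<rho> (-1) * q_coeff p s x (-1) + \<rho> 0 * q_coeff p s x 0"]
      q[of "-1"] q[of 0] assms by (simp add: L_coeff_def)
  show "\<bar>L_coeff \<kappa> p s \<rho> x (Inr 0)\<bar> \<le> (\<kappa> + 2 * (p + s)\<^sup>2) * n"
    using gen[OF x[of "Inr 0"], of s "\<rho> 0 * q_coeff p s x 0 - \<rho> (-1) * q_coeff p s x (-1)"]
      q[of "-1"] q[of 0] assms by (simp add: L_coeff_def)
qed

text \<open>Inside the cut-off the truncated equation holds exactly, so the residual at \<mu> is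
  (\<mu> - lam) times \<open>J_coeff x\<close>. Applying the full operator also excites the modes at
  distance N + 1, where only the coupling contributes. The normalization of \<open>x (Inl 0)\<close>
  keeps the vector away from 0.\<close>

lemma approximate_eigenvector:
  fixes N :: int and \<kappa> p s :: real and \<rho> :: "int \<Rightarrow> real"
  defines "R \<equiv> \<kappa> + 2 * (p + s)\<^sup>2" and "a \<equiv> \<kappa> - p\<^sup>2 * ((\<rho> (- 1) + \<rho> 0) / 2)"
  assumes N: "1 \<le> N" and \<kappa>: "0 < \<kappa>" and p: "0 \<le> p" "p\<^sup>2 < \<kappa>" and s: "0 \<le> s" "4.92 * \<kappa> \<le> s\<^sup>2"
    and \<rho>: "\<And>j. 0 \<le> \<rho> j" "\<And>j. \<rho> j \<le> 1" "0.9 \<le> \<rho> 0" "0.9 \<le> \<rho> (- 1)"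
  shows "\<exists>lam x. sqrt (\<kappa> / 5 * a) \<le> lam \<and> lam \<le> R * (2 + (2 * R + a) / (\<kappa> / 5)) \<and>
      (\<forall>i. i \<notin> modes N \<longrightarrow> x i = 0) \<and> x (Inl 0) = 1 \<and>
      (\<forall>\<mu>. (\<Sum>i\<in>modes (N + 1). (L_coeff \<kappa> p s \<rho> x i + \<mu> * J_coeff x i)\<^sup>2)
         \<le> ((\<mu> - lam)\<^sup>2 + 16 * (p + s)^4 / (4 * (of_int N)\<^sup>2 - 1)) * (\<Sum>i\<in>modes N. (x i)\<^sup>2))"
proof -
  let ?L = "L_coeff \<kappa> p s \<rho>"
  let ?e = "\<lambda>i. if i = Inl 0 then 1 else 0 :: real"
  have fin: "finite (modes M)" for M by simp
  have apos: "0 < a"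
  proof -
    have "p\<^sup>2 * ((\<rho> (- 1) + \<rho> 0) / 2) \<le> p\<^sup>2 * 1"
      by (rule mult_left_mono) (use \<rho>(2)[of 0] \<rho>(2)[of "-1"] in auto)
    then show ?thesis using p unfolding a_def by simp
  qed
  have Rpos: "0 < R" unfolding R_def using \<kappa> by (simp add: add_pos_nonneg)
  have "\<exists>lam x. sqrt (\<kappa> / 5 * a) \<le> lam \<and> lam \<le> R * (2 + (2 * R + a) / (\<kappa> / 5)) \<and>
      (\<forall>i. i \<notin> modes N \<longrightarrow> x i = 0) \<and> x (Inl 0) = 1 \<and> (\<forall>i\<in>modes N. ?L x i + lam * J_coeff x i = 0)"
  proof (rule real_eigenvalue_of_skew_times_symmetric[OF fin, of "Inl 0" N "Inr 0"])
    fix x y :: "int + int \<Rightarrow> real"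
    assume x: "\<And>i. i \<notin> modes N \<Longrightarrow> x i = 0" and y: "\<And>i. i \<notin> modes N \<Longrightarrow> y i = 0"
    show "(\<Sum>i\<in>modes N. x i * ?L y i) = (\<Sum>i\<in>modes N. y i * ?L x i)"
      using L_coeff_form[of N x \<kappa> p s \<rho> y] L_coeff_form[of N y \<kappa> p s \<rho> x] x y by (simp add: mult.commute)
  next
    fix x :: "int + int \<Rightarrow> real"
    show "(\<Sum>i\<in>modes N. x i * J_coeff x i) = 0"
      unfolding sum_modes by (simp add: J_coeff_def)
  next
    fix x :: "int + int \<Rightarrow> real"
    assume "\<And>i. i \<notin> modes N \<Longrightarrow> x i = 0" "x (Inl 0) = 0"
    then show "\<kappa> / 5 * (\<Sum>i\<in>modes N. (x i)\<^sup>2) \<le> (\<Sum>i\<in>modes N. x i * ?L x i)"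
      using L_coeff_coercive[OF N \<kappa> _ s(2), of p \<rho> x] p \<rho> by auto
  next
    fix x :: "int + int \<Rightarrow> real"
    assume x: "\<And>i. i \<notin> modes N \<Longrightarrow> x i = 0"
    have "\<bar>x i\<bar> \<le> L2_set x (modes N)" for i
    proof (cases "i \<in> modes N")
      case True
      then show ?thesis using member_le_L2_set[OF fin True, of "\<lambda>i. \<bar>x i\<bar>"] by (simp add: L2_set_def)
    qed (simp add: x)
    then show "\<bar>?L x (Inl 0)\<bar> \<le> R * L2_set x (modes N)" "\<bar>?L x (Inr 0)\<bar> \<le> R * L2_set x (modes N)"
      unfolding R_def using L_coeff_row_bound[of \<kappa> p s \<rho> x "L2_set x (modes N)"] \<kappa> p s \<rho> by auto
  next
    \<comment> \<open>The constant mode enters \<open>q_coeff\<close> at -1 and 0, each time with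
      value p / 2; hence the average of the two weights in \<open>a\<close>.\<close>
    show "?L ?e (Inl 0) = - a"
      by (simp add: L_coeff_def q_coeff_def a_def power2_eq_square field_simps)
  qed (use N \<kappa> apos Rpos in \<open>auto simp: modes_iff L_coeff_add L_coeff_scale J_coeff_def fun_eq_iff split: sum.split\<close>)
  then obtain lam x where lam: "sqrt (\<kappa> / 5 * a) \<le> lam" "lam \<le> R * (2 + (2 * R + a) / (\<kappa> / 5))"
    and x: "\<And>i. i \<notin> modes N \<Longrightarrow> x i = 0" and x0: "x (Inl 0) = 1"
    and eq: "\<And>i. i \<in> modes N \<Longrightarrow> ?L x i + lam * J_coeff x i = 0"
    by blast
  define S where "S = (\<Sum>i\<in>modes N. (x i)\<^sup>2)"
  define D where "D = 4 * (of_int N)\<^sup>2 - (1::real)"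
  have N2: "1 \<le> (real_of_int N)\<^sup>2" using N by (simp add: one_le_power)
  then have D: "0 < D" unfolding D_def by linarith
  have J_sq: "(\<Sum>i\<in>modes N. (J_coeff x i)\<^sup>2) = S"
    unfolding S_def sum_modes by (simp add: J_coeff_def add.commute)
  have "(\<Sum>i\<in>modes N. x i * ?L x i) = (\<Sum>i\<in>modes N. x i * (?L x i + lam * J_coeff x i)) - lam * (\<Sum>i\<in>modes N. x i * J_coeff x i)"
    unfolding sum_distrib_left sum_subtractf[symmetric] by (rule sum.cong) (auto simp: algebra_simps)
  also have "(\<Sum>i\<in>modes N. x i * (?L x i + lam * J_coeff x i)) = 0"
    by (rule sum.neutral) (use eq in simp)
  also have "(\<Sum>i\<in>modes N. x i * J_coeff x i) = 0" unfolding sum_modes by (simp add: J_coeff_def)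
  finally have form0: "(\<Sum>i\<in>modes N. x i * ?L x i) = 0" by simp
  let ?h = "\<lambda>m. (4 * (of_int m)\<^sup>2 - 1) * ((x (Inl m))\<^sup>2 + (x (Inr m))\<^sup>2)"
  \<comment> \<open>Dropping the nonnegative interaction from the vanishing form leaves a
    nonpositive kinetic sum. Its only negative terms are the two constants, with coefficient -1, so
    these dominate the weighted sum over all other modes.\<close>
  have "0 \<le> (\<Sum>j\<in>{- N - 1..N}. \<rho> j * (q_coeff p s x j * q_coeff p s x j))"
    by (intro sum_nonneg mult_nonneg_nonneg[OF \<rho>(1)]) simp
  moreover have "(\<Sum>m\<in>{- N..N}. \<kappa> * (4 * (of_int m)\<^sup>2 - 1) * (x (Inl m) * x (Inl m) + x (Inr m) * x (Inr m)))
     = \<kappa> * (\<Sum>m\<in>{- N..N}. ?h m)"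
    unfolding sum_distrib_left by (simp add: power2_eq_square mult.assoc)
  ultimately have "\<kappa> * (\<Sum>m\<in>{- N..N}. ?h m) \<le> 0"
    using form0 L_coeff_form[of N x \<kappa> p s \<rho> x] x by simp
  then have h_le: "(\<Sum>m\<in>{- N..N}. ?h m) \<le> 0" using \<kappa> by (simp add: mult_le_0_iff)
  have tail: "D * ((x (Inl m))\<^sup>2 + (x (Inr m))\<^sup>2) \<le> S" if m: "\<bar>m\<bar> = N" for m
  proof -
    have "(\<Sum>l\<in>{0, m}. ?h l) \<le> (\<Sum>l\<in>{- N..N}. ?h l)"
    proof (rule sum_mono2)
      fix l assume "l \<in> {- N..N} - {0, m}"
      then have "1 \<le> \<bar>l\<bar>" by auto
      then have "1 \<le> \<bar>real_of_int l\<bar>" by linarith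
      then have "1 \<le> (real_of_int l)\<^sup>2" using one_le_power[of "\<bar>real_of_int l\<bar>" 2] by simp
      then show "0 \<le> ?h l" by (intro mult_nonneg_nonneg) auto
    qed (use m N in auto)
    moreover have "(real_of_int m)\<^sup>2 = (real_of_int N)\<^sup>2" using m by (metis of_int_abs power2_abs)
    ultimately have "D * ((x (Inl m))\<^sup>2 + (x (Inr m))\<^sup>2) \<le> (x (Inl 0))\<^sup>2 + (x (Inr 0))\<^sup>2"
      using h_le m N unfolding D_def by simp
    also have "\<dots> = (\<Sum>i\<in>{Inl 0, Inr 0}. (x i)\<^sup>2)" by simp
    also have "\<dots> \<le> S" unfolding S_def by (rule sum_mono2) (use N in auto)
    finally show ?thesis .
  qed
  have x_tail: "\<bar>x (Inl m)\<bar> \<le> sqrt (S / D)" "\<bar>x (Inr m)\<bar> \<le> sqrt (S / D)" if m: "N \<le> \<bar>m\<bar>" for m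
  proof -
    have "(x (Inl m))\<^sup>2 + (x (Inr m))\<^sup>2 \<le> S / D"
    proof (cases "\<bar>m\<bar> = N")
      case True
      then show ?thesis using tail[OF True] D by (simp add: pos_le_divide_eq mult.commute)
    next
      case False
      then have "m \<notin> {- N..N}" using m by auto
      then have "x (Inl m) = 0" "x (Inr m) = 0" using x modes_iff[of m N] by blast+
      then show ?thesis using D by (simp add: S_def sum_nonneg)
    qed
    then have "(x (Inl m))\<^sup>2 \<le> S / D" "(x (Inr m))\<^sup>2 \<le> S / D"
      by (smt (verit) zero_le_power2)+
    then show "\<bar>x (Inl m)\<bar> \<le> sqrt (S / D)" "\<bar>x (Inr m)\<bar> \<le> sqrt (S / D)"
      by (simp_all add: real_le_rsqrt)
  qed
  \<comment> \<open>The condition on \<open>j\<close> says that both neighbours \<open>j\<close> and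
    \<open>j + 1\<close> lie at or beyond the cut-off; this includes the indices just inside that
    feed the modes just outside.\<close>
  have q_tail: "\<bar>\<rho> j * q_coeff p s x j\<bar> \<le> (p + s) * sqrt (S / D)" if j: "j \<ge> N \<or> j + 1 \<le> - N" for j
  proof -
    define t where "t = sqrt (S / D)"
    have "N \<le> \<bar>j\<bar>" "N \<le> \<bar>j + 1\<bar>" "N \<le> \<bar>- j\<bar>" "N \<le> \<bar>- j - 1\<bar>" using j N by auto
    then have "\<bar>x (Inl j)\<bar> \<le> t" "\<bar>x (Inl (j + 1))\<bar> \<le> t" "\<bar>x (Inr (- j))\<bar> \<le> t" "\<bar>x (Inr (- j - 1))\<bar> \<le> t"
      unfolding t_def by (auto intro: x_tail simp del: abs_minus_cancel)
    then have "\<bar>x (Inl j) + x (Inl (j + 1))\<bar> \<le> 2 * t" "\<bar>x (Inr (- j)) - x (Inr (- j - 1))\<bar> \<le> 2 * t"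
      by linarith+
    then have "\<bar>p / 2 * (x (Inl j) + x (Inl (j + 1)))\<bar> \<le> p / 2 * (2 * t)"
       "\<bar>s / 2 * (x (Inr (- j)) - x (Inr (- j - 1)))\<bar> \<le> s / 2 * (2 * t)"
      using p s by (auto simp only: abs_mult abs_divide abs_of_nonneg abs_numeral intro!: mult_left_mono)
    then have "\<bar>q_coeff p s x j\<bar> \<le> (p + s) * t" unfolding q_coeff_def by (simp add: algebra_simps)
    then show ?thesis using \<rho>(1,2)[of j] mult_mono[of "\<rho> j" 1 "\<bar>q_coeff p s x j\<bar>" "(p + s) * t"]
      by (simp add: abs_mult t_def)
  qed
  have L_tail: "(?L x i)\<^sup>2 \<le> 4 * (p + s)^4 / D * S" if "i \<notin> modes N" for i
  proof -
    have *: "(?L x i)\<^sup>2 \<le> 4 * (p + s)^4 / D * S" if "?L x i = t * b" "0 \<le> t" "t \<le> p + s" "\<bar>b\<bar> \<le> 2 * ((p + s) * sqrt (S / D))" for t b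
    proof -
      have "\<bar>t * b\<bar> \<le> (p + s) * (2 * ((p + s) * sqrt (S / D)))"
        unfolding abs_mult by (rule mult_mono) (use that in auto)
      then have "(?L x i)\<^sup>2 \<le> ((p + s) * (2 * ((p + s) * sqrt (S / D))))\<^sup>2"
        unfolding that(1) by (metis abs_ge_zero power2_abs power_mono)
      also have "\<dots> = 4 * (p + s)^4 / D * S"
        using D by (simp add: power_mult_distrib S_def sum_nonneg)
      finally show ?thesis .
    qed
    show ?thesis
    proof (cases i)
      case (Inl m)
      then have m: "m < - N \<or> N < m" using that by (auto simp: modes_iff)
      show ?thesis
        by (rule *[of p "\<rho> (m - 1) * q_coeff p s x (m - 1) + \<rho> m * q_coeff p s x m"])
          (use m Inl x[OF that] q_tail[of m] q_tail[of "m - 1"] p s in \<open>auto simp: L_coeff_def\<close>)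
    next
      case (Inr m)
      then have m: "m < - N \<or> N < m" using that by (auto simp: modes_iff)
      show ?thesis
        by (rule *[of s "\<rho> (- m) * q_coeff p s x (- m) - \<rho> (- m - 1) * q_coeff p s x (- m - 1)"])
          (use m Inr x[OF that] q_tail[of "- m"] q_tail[of "- m - 1"] p s in \<open>auto simp: L_coeff_def\<close>)
    qed
  qed
  have "(\<Sum>i\<in>modes (N + 1). (?L x i + \<mu> * J_coeff x i)\<^sup>2) \<le> ((\<mu> - lam)\<^sup>2 + 16 * (p + s)^4 / D) * S" for \<mu>
  proof -
    \<comment> \<open>Each of these four indices contributes at most 4 (p + s)^4 S / D, which is the
      origin of the factor 16.\<close>
    let ?E = "{Inl (N + 1), Inl (- N - 1), Inr (N + 1), Inr (- N - 1)}"
    have J_tail: "J_coeff x i = 0" if "i \<notin> modes N" for i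
      using that x by (auto simp: J_coeff_def modes_iff split: sum.split)
    have split: "modes (N + 1) = modes N \<union> ?E"
    proof (rule set_eqI)
      fix i show "i \<in> modes (N + 1) \<longleftrightarrow> i \<in> modes N \<union> ?E"
        using N by (cases i) (auto simp only: Un_iff modes_iff insert_iff empty_iff sum.inject sum.distinct atLeastAtMost_iff)
    qed
    have E: "i \<notin> modes N" if "i \<in> ?E" for i using that by auto
    have "(\<Sum>i\<in>modes (N + 1). (?L x i + \<mu> * J_coeff x i)\<^sup>2) =
        (\<Sum>i\<in>modes N. (?L x i + \<mu> * J_coeff x i)\<^sup>2) + (\<Sum>i\<in>?E. (?L x i + \<mu> * J_coeff x i)\<^sup>2)"
      unfolding split by (rule sum.union_disjoint) (use E in auto)
    also have "(\<Sum>i\<in>modes N. (?L x i + \<mu> * J_coeff x i)\<^sup>2) = (\<Sum>i\<in>modes N. (\<mu> - lam)\<^sup>2 * (J_coeff x i)\<^sup>2)"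
    proof (rule sum.cong)
      fix i assume "i \<in> modes N"
      from eq[OF this] have "?L x i + \<mu> * J_coeff x i = (\<mu> - lam) * J_coeff x i" by (simp add: algebra_simps)
      then show "(?L x i + \<mu> * J_coeff x i)\<^sup>2 = (\<mu> - lam)\<^sup>2 * (J_coeff x i)\<^sup>2" by (simp add: power_mult_distrib)
    qed simp
    also have "\<dots> = (\<mu> - lam)\<^sup>2 * S" unfolding sum_distrib_left[symmetric] J_sq ..
    also have "(\<Sum>i\<in>?E. (?L x i + \<mu> * J_coeff x i)\<^sup>2) \<le> (\<Sum>i\<in>?E. 4 * (p + s)^4 / D * S)"
      by (rule sum_mono) (use L_tail[OF E] J_tail[OF E] in simp)
    also have "\<dots> \<le> 4 * (4 * (p + s)^4 / D * S)"
    proof -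
      have "card ?E \<le> 4" by (auto simp: card_insert_if)
      then have "real (card ?E) \<le> 4" by linarith
      moreover have "0 \<le> 4 * (p + s)^4 / D * S" using D by (simp add: S_def sum_nonneg)
      ultimately show ?thesis unfolding sum_constant by (rule mult_right_mono)
    qed
    finally show ?thesis by (simp add: algebra_simps)
  qed
  then show ?thesis using lam x x0 unfolding S_def D_def by blast
qed

section \<open>Weak derivatives on the circle\<close>

lemma smooth_periodicD:
  assumes "smooth_periodic T \<phi>"
  obtains \<phi>' where "smooth_periodic T \<phi>'" "\<And>x. (\<phi> has_vector_derivative \<phi>' x) (at x)"
proof -
  obtain D :: "nat \<Rightarrow> real \<Rightarrow> complex" where D: "D 0 = \<phi>" "\<And>m x. (D m has_vector_derivative D (Suc m) x) (at x)"
    and per: "\<And>x. \<phi> (x + T) = \<phi> x"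
    using assms unfolding smooth_periodic_def by auto
  have "D 1 (x + T) = D 1 x" for x
  proof -
    have "((\<lambda>y. D 0 (y + T)) has_vector_derivative 1 *\<^sub>R D 1 (x + T)) (at x)"
      using D(2)[of 0 "x + T"]
      by (intro vector_diff_chain_at[of "\<lambda>y. y + T" 1 x "D 0", unfolded o_def])
        (auto intro!: derivative_eq_intros)
    moreover have "(\<lambda>y. D 0 (y + T)) = D 0" using per D(1) by auto
    ultimately show ?thesis using vector_derivative_unique_at D(2)[of 0 x] by fastforce
  qed
  then have "smooth_periodic T (D 1)"
    unfolding smooth_periodic_def using D(2) by (auto intro!: exI[of _ "\<lambda>m. D (Suc m)"])
  then show thesis using that D(2)[of 0] D(1) by auto
qed

lemma smooth_periodic_continuous:
  assumes "smooth_periodic T \<phi>"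
  shows "continuous_on S \<phi>"
proof -
  obtain \<phi>' where "\<And>x. (\<phi> has_vector_derivative \<phi>' x) (at x)" using smooth_periodicD[OF assms] by blast
  then show ?thesis
    by (meson continuous_at_imp_continuous_on has_vector_derivative_continuous)
qed

lemma smooth_periodic_L2:
  assumes "smooth_periodic T \<phi>"
  shows "\<phi> \<in> L2_circle T"
proof -
  have "\<And>x. \<phi> (x + T) = \<phi> x" using assms by (simp add: smooth_periodic_def)
  then show ?thesis unfolding L2_circle_def
    by (auto intro!: borel_measurable_continuous_onI borel_integrable_atLeastAtMost'
        continuous_intros smooth_periodic_continuous[OF assms])
qed

lemma smooth_periodic_weak_deriv:
  assumes T: "0 \<le> T" and f: "smooth_periodic T f" and g: "smooth_periodic T g"
    and fg: "\<And>x. (f has_vector_derivative g x) (at x)"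
  shows "weak_deriv T f g"
  unfolding weak_deriv_def
proof (intro allI impI)
  fix \<phi> assume \<phi>: "smooth_periodic T \<phi>"
  obtain \<phi>' where \<phi>': "smooth_periodic T \<phi>'" "\<And>x. (\<phi> has_vector_derivative \<phi>' x) (at x)"
    using smooth_periodicD[OF \<phi>] by blast
  have d: "vector_derivative \<phi> (at x) = \<phi>' x" for x by (rule vector_derivative_at) (rule \<phi>')
  note cont = smooth_periodic_continuous[OF f] smooth_periodic_continuous[OF g]
    smooth_periodic_continuous[OF \<phi>] smooth_periodic_continuous[OF \<phi>'(1)]
  have "(LINT x:{0..T}|lborel. f x * \<phi>' x + g x * \<phi> x) = f T * \<phi> T - f 0 * \<phi> 0"
    unfolding set_lebesgue_integral_def
  proof (rule integral_FTC_atLeastAtMost[OF T])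
    fix x show "((\<lambda>x. f x * \<phi> x) has_vector_derivative f x * \<phi>' x + g x * \<phi> x) (at x within {0..T})"
      using has_vector_derivative_mult[OF fg \<phi>'(2), of x]
      by (auto simp: algebra_simps intro: has_vector_derivative_at_within)
  qed (intro continuous_intros cont)
  also have "\<dots> = 0"
    using f \<phi> unfolding smooth_periodic_def by (metis add_0 cancel_comm_monoid_add_class.diff_cancel)
  also have "(LINT x:{0..T}|lborel. f x * \<phi>' x + g x * \<phi> x) =
      (LINT x:{0..T}|lborel. f x * \<phi>' x) + (LINT x:{0..T}|lborel. g x * \<phi> x)"
    by (rule set_integral_add) (intro borel_integrable_atLeastAtMost' continuous_intros cont)+
  finally show "(LINT x:{0..T}|lborel. f x * vector_derivative \<phi> (at x)) = - (LINT x:{0..T}|lborel. g x * \<phi> x)"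
    unfolding d by (simp add: eq_neg_iff_add_eq_0)
qed

lemma smooth_periodic_sobolev:
  assumes "0 \<le> T"
  shows "smooth_periodic T f \<Longrightarrow> f \<in> sobolev s T"
proof (induction s arbitrary: f)
  case 0
  then show ?case by (simp add: smooth_periodic_L2)
next
  case (Suc s)
  obtain g where "smooth_periodic T g" "\<And>x. (f has_vector_derivative g x) (at x)"
    using smooth_periodicD[OF Suc.prems] by blast
  then show ?case
    using Suc.IH smooth_periodic_weak_deriv[OF assms Suc.prems] smooth_periodic_L2[OF Suc.prems] by auto
qed

text \<open>The complex derivatives of an entire function supply the whole sequence of real
  derivatives at once; this certifies the test functions built below.\<close>

lemma entire_smooth_periodic:
  assumes hol: "F holomorphic_on UNIV" and per: "\<And>x. F (of_real (x + T)) = F (of_real x)"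
  shows "smooth_periodic T (\<lambda>x. F (of_real x))"
  unfolding smooth_periodic_def
proof (intro conjI exI[of _ "\<lambda>m x. (deriv ^^ m) F (of_real x)"] allI)
  fix m :: nat and x :: real
  have "(deriv ^^ m) F holomorphic_on UNIV" by (rule holomorphic_higher_deriv[OF hol]) simp
  then have "((deriv ^^ m) F has_field_derivative (deriv ^^ Suc m) F (of_real x)) (at (of_real x))"
    using holomorphic_derivI[of _ UNIV "of_real x"] by simp
  then show "((\<lambda>x. (deriv ^^ m) F (of_real x)) has_vector_derivative (deriv ^^ Suc m) F (of_real x)) (at x)"
    by (rule has_vector_derivative_real_field)
qed (use per in auto)

section \<open>Uniqueness of weak derivatives\<close>

lemma Int_stable_boxes: "Int_stable (range (\<lambda>(a, b). box a b :: 'a::euclidean_space set))"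
  by (auto simp: Int_stable_def box_Int_box)

text \<open>A \<pi>-\<lambda> argument: open intervals generate the Borel sets and are stable under
  intersection, while the complement step uses the vanishing total integral.\<close>

lemma integrable_zero_on_intervals:
  fixes g :: "real \<Rightarrow> complex"
  assumes g: "integrable lborel g" and zero: "\<And>a b. a < b \<Longrightarrow> (LINT x:{a<..<b}|lborel. g x) = 0"
    and total: "(LINT x|lborel. g x) = 0"
  shows "AE x in lborel. g x = 0"
proof (rule sigma_finite_measure.density_zero[OF sigma_finite_lborel g])
  fix A :: "real set" assume "A \<in> sets lborel"
  then have A: "A \<in> sigma_sets UNIV (range (\<lambda>(a, b). box a b))"
    by (simp add: borel_eq_box)
  have gm: "set_integrable lborel S g" if "S \<in> sets borel" for S
    using g that unfolding set_integrable_def by (intro integrable_mult_indicator) auto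
  have meas: "S \<in> sets borel" if "S \<in> sigma_sets UNIV (range (\<lambda>(a, b). box a b))" for S :: "real set"
    using that by (simp add: borel_eq_box)
  have "range (\<lambda>(a, b). box a b :: real set) \<subseteq> Pow UNIV" by simp
  with Int_stable_boxes show "(LINT x:A|lborel. g x) = 0"
    using A
  proof (induction rule: sigma_sets_induct_disjoint)
    case (basic A)
    then obtain a b where "A = {a<..<b}" by (auto simp: box_real)
    then show ?case using zero[of a b]
      by (cases "a < b") (auto simp: set_lebesgue_integral_def)
  next
    case empty
    show ?case by (simp add: set_lebesgue_integral_def)
  next
    case (compl A)
    note [measurable] = meas[OF compl(1)]
    have "(LINT x:A \<union> (UNIV - A)|lborel. g x) = (LINT x:A|lborel. g x) + (LINT x:UNIV - A|lborel. g x)"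
      by (rule set_integral_Un) (auto intro!: gm)
    then show ?case using compl total by (simp add: set_lebesgue_integral_def)
  next
    case (union A)
    have [measurable]: "A i \<in> sets borel" for i using union(2) meas by blast
    have "(LINT x:(\<Union>i. A i)|lborel. g x) = (\<Sum>i. (LINT x:(A i)|lborel. g x))"
      by (rule lebesgue_integral_countable_add) (use union in \<open>auto simp: disjoint_family_on_def intro!: gm\<close>)
    then show ?case using union by simp
  qed
qed

text \<open>For \<open>0 \<le> a < b \<le> T\<close> the product \<open>sin (\<pi> (x - a) / T) sin (\<pi> (b - x) / T)\<close> is \<open>T\<close>-periodic and, on
  \<open>{0..T}\<close>, positive exactly between \<open>a\<close> and \<open>b\<close>; so \<open>exp (- exp (- n h))\<close> with this product as \<open>h\<close> is an
  entire test function converging boundedly to the indicator of the interval.\<close>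

lemma circle_null_function:
  assumes T: "0 < T" and g: "set_integrable lborel {0..T} g"
    and zero: "\<And>\<phi>. smooth_periodic T \<phi> \<Longrightarrow> (LINT x:{0..T}|lborel. g x * \<phi> x) = 0"
  shows "AE x in lborel. x \<in> {0..T} \<longrightarrow> g x = 0"
proof -
  let ?G = "\<lambda>x. indicator {0..T} x *\<^sub>R g x"
  have G: "integrable lborel ?G" using g unfolding set_integrable_def .
  have gm[measurable]: "?G \<in> borel_measurable lborel" using G by (rule borel_measurable_integrable)
  have "smooth_periodic T (\<lambda>x. 1)"
    using entire_smooth_periodic[of "\<lambda>_. 1" T] by simp
  from zero[OF this] have total: "(LINT x|lborel. ?G x) = 0" by (simp add: set_lebesgue_integral_def)
  have int0: "(LINT x:{a<..<b}|lborel. ?G x) = 0" if ab: "0 \<le> a" "a < b" "b \<le> T" for a b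
  proof -
    define h where "h x = sin (pi * (x - a) / T) * sin (pi * (b - x) / T)" for x
    define F where "F n z = exp (- exp (- of_nat n * (sin (of_real pi * (z - of_real a) / of_real T) *
        sin (of_real pi * (of_real b - z) / of_real T))))" for n and z :: complex
    have Fh: "F n (of_real x) = of_real (exp (- exp (- real n * h x)))" for n x
      by (simp add: F_def h_def flip: exp_of_real sin_of_real)
    have "h (x + T) = h x" for x
    proof -
      have "pi * (x + T - a) / T = pi * (x - a) / T + pi" "pi * (b - (x + T)) / T = pi * (b - x) / T - pi"
        using T by (simp_all add: field_simps)
      then show ?thesis unfolding h_def by (simp add: sin_diff)
    qed
    then have "F n (of_real (x + T)) = F n (of_real x)" for n x by (simp only: Fh)
    moreover have "F n holomorphic_on UNIV" for n
      unfolding F_def using T by (auto intro!: holomorphic_intros)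
    ultimately have smooth: "smooth_periodic T (\<lambda>x. F n (of_real x))" for n
      by (intro entire_smooth_periodic)
    have sin_pos: "0 < sin (pi * y / T)" if "0 < y" "y < T" for y
      by (rule sin_gt_zero) (use that T in \<open>simp_all add: pos_divide_less_eq\<close>)
    have sin_neg: "sin (pi * y / T) < 0" if "- T < y" "y < 0" for y
      using sin_pos[of "- y"] that by simp
    \<comment> \<open>The excluded points are possible zeros of \<open>h\<close>: besides
      \<open>a\<close> and \<open>b\<close>, the product vanishes at 0 and \<open>T\<close> when
      \<open>a = 0\<close> or \<open>b = T\<close>. A zero of \<open>h\<close> would give the limit
      exp (- 1).\<close>
    have lim: "(\<lambda>n. exp (- exp (- real n * h x))) \<longlonglongrightarrow> indicator {a<..<b} x"
      if x: "x \<in> {0..T}" "x \<notin> {0, a, b, T}" for x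
    proof (cases "a < x \<and> x < b")
      case True
      have "0 < sin (pi * (x - a) / T)" "0 < sin (pi * (b - x) / T)"
        by (rule sin_pos; use True x ab in auto)+
      then have "0 < h x" unfolding h_def by (rule mult_pos_pos)
      then have "(\<lambda>n. exp (- exp (- real n * h x))) \<longlonglongrightarrow> 1" by real_asymp
      then show ?thesis using True by simp
    next
      case False
      have "h x < 0"
      proof (cases "x < a")
        case True
        have "sin (pi * (x - a) / T) < 0" by (rule sin_neg) (use True x ab in auto)
        moreover have "0 < sin (pi * (b - x) / T)" by (rule sin_pos) (use True x ab in auto)
        ultimately show ?thesis unfolding h_def by (rule mult_neg_pos)
      next
        case F: False
        have "0 < sin (pi * (x - a) / T)" by (rule sin_pos) (use F False x ab in auto)
        moreover have "sin (pi * (b - x) / T) < 0" by (rule sin_neg) (use F False x ab in auto)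
        ultimately show ?thesis unfolding h_def by (rule mult_pos_neg)
      qed
      then have "(\<lambda>n. exp (- exp (- real n * h x))) \<longlonglongrightarrow> 0" by real_asymp
      then show ?thesis using False by simp
    qed
    have "(\<lambda>n. LINT x|lborel. ?G x * F n (of_real x)) \<longlonglongrightarrow> (LINT x|lborel. indicator {a<..<b} x *\<^sub>R ?G x)"
    proof (rule integral_dominated_convergence[where w = "\<lambda>x. norm (?G x)"])
      show "AE x in lborel. (\<lambda>n. ?G x * F n (of_real x)) \<longlonglongrightarrow> indicator {a<..<b} x *\<^sub>R ?G x"
      proof -
        have "AE x in lborel. x \<notin> {0, a, b, T}"
          by (rule AE_not_in) (auto intro!: finite_imp_null_set_lborel)
        then show ?thesis
        proof eventually_elim
          case (elim x)
          show ?case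
          proof (cases "x \<in> {0..T}")
            case True
            have "(\<lambda>n. ?G x * of_real (exp (- exp (- real n * h x)))) \<longlonglongrightarrow> ?G x * of_real (indicator {a<..<b} x)"
              by (intro tendsto_intros lim True elim)
            then show ?thesis unfolding Fh by (simp add: scaleR_conv_of_real mult.commute)
          qed simp
        qed
      qed
      show "AE x in lborel. norm (?G x * F n (of_real x)) \<le> norm (?G x)" for n
        unfolding Fh norm_mult norm_of_real by (intro AE_I2 mult_left_le) auto
      show "(\<lambda>x. ?G x * F n (of_real x)) \<in> borel_measurable lborel" for n
        using borel_measurable_continuous_onI[OF smooth_periodic_continuous[OF smooth[of n]]] gm by measurable
      show "(\<lambda>x. indicator {a<..<b} x *\<^sub>R ?G x) \<in> borel_measurable lborel" using gm by measurable
      show "integrable lborel (\<lambda>x. norm (?G x))" using G by (rule integrable_norm)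
    qed
    moreover have "(LINT x|lborel. ?G x * F n (of_real x)) = 0" for n
      using zero[OF smooth[of n]] by (simp add: set_lebesgue_integral_def)
    ultimately show ?thesis unfolding set_lebesgue_integral_def by (simp add: LIMSEQ_const_iff)
  qed
  have "AE x in lborel. ?G x = 0"
  proof (rule integrable_zero_on_intervals[OF G _ total])
    fix a b :: real assume "a < b"
    show "(LINT x:{a<..<b}|lborel. ?G x) = 0"
    proof (cases "max a 0 < min b T")
      case True
      have "(LINT x:{a<..<b}|lborel. ?G x) = (LINT x:{max a 0<..<min b T}|lborel. ?G x)"
        unfolding set_lebesgue_integral_def
      proof (rule integral_cong_AE)
        have "AE x in lborel. x \<notin> {0, T}"
          by (rule AE_not_in) (auto intro!: finite_imp_null_set_lborel)
        then show "AE x in lborel. indicator {a<..<b} x *\<^sub>R ?G x = indicator {max a 0<..<min b T} x *\<^sub>R ?G x"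
          by eventually_elim (auto simp: indicator_def)
      qed (use gm in measurable)
      then show ?thesis using int0[of "max a 0" "min b T"] True by simp
    next
      case False
      show ?thesis
        unfolding set_lebesgue_integral_def
      proof (rule integral_eq_zero_AE)
        have "AE x in lborel. x \<notin> {0, T}"
          by (rule AE_not_in) (auto intro!: finite_imp_null_set_lborel)
        then show "AE x in lborel. indicator {a<..<b} x *\<^sub>R ?G x = 0"
          by eventually_elim (use False \<open>a < b\<close> T in \<open>auto simp: indicator_def\<close>)
      qed
    qed
  qed
  then show ?thesis by eventually_elim auto
qed

lemma L2_circle_integrable:
  assumes "f \<in> L2_circle T"
  shows "set_integrable lborel {0..T} f"
proof -
  have m: "f \<in> borel_measurable borel" and i: "set_integrable lborel {0..T} (\<lambda>x. (norm (f x))\<^sup>2)"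
    using assms by (auto simp: L2_circle_def)
  have "set_integrable lborel {0..T} (\<lambda>x. 1 + (norm (f x))\<^sup>2)"
    by (intro set_integral_add i borel_integrable_atLeastAtMost') simp
  then show ?thesis
    unfolding set_integrable_def
  proof (rule Bochner_Integration.integrable_bound)
    have "norm z \<le> 1 + (norm z)\<^sup>2" for z :: complex
    proof -
      have "0 \<le> (norm z - 1)\<^sup>2 + (norm z)\<^sup>2 + 1" by simp
      then show ?thesis by (simp add: power2_diff)
    qed
    then show "AE x in lborel. norm (indicator {0..T} x *\<^sub>R f x) \<le> norm (indicator {0..T} x *\<^sub>R (1 + (norm (f x))\<^sup>2))"
      by (intro AE_I2) (auto simp: indicator_def)
  qed (use m in measurable)
qed

lemma weak_deriv_unique:
  assumes T: "0 < T" and g: "g1 \<in> L2_circle T" "g2 \<in> L2_circle T"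
    and w: "weak_deriv T f g1" "weak_deriv T f g2"
  shows "AE x in lborel. x \<in> {0..T} \<longrightarrow> g1 x = g2 x"
proof -
  have i: "set_integrable lborel {0..T} g1" "set_integrable lborel {0..T} g2"
    using g by (auto intro: L2_circle_integrable)
  have "AE x in lborel. x \<in> {0..T} \<longrightarrow> g1 x - g2 x = 0"
  proof (rule circle_null_function[OF T])
    show "set_integrable lborel {0..T} (\<lambda>x. g1 x - g2 x)" using i by (rule set_integral_diff)
    fix \<phi> assume \<phi>: "smooth_periodic T \<phi>"
    have cont: "continuous_on {0..T} \<phi>" by (rule smooth_periodic_continuous[OF \<phi>])
    have "bounded (\<phi> ` {0..T})" by (rule compact_imp_bounded[OF compact_continuous_image[OF cont]]) simp
    then obtain M where M: "\<And>x. x \<in> {0..T} \<Longrightarrow> norm (\<phi> x) \<le> M"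
      unfolding bounded_iff by (meson imageI)
    have p: "set_integrable lborel {0..T} (\<lambda>x. g x * \<phi> x)" if "set_integrable lborel {0..T} g" for g
    proof -
      have "integrable lborel (\<lambda>x. M *\<^sub>R (indicator {0..T} x *\<^sub>R g x))"
        using that unfolding set_integrable_def by (intro integrable_scaleR_right)
      then show ?thesis
        unfolding set_integrable_def
      proof (rule Bochner_Integration.integrable_bound)
        have [measurable]: "\<phi> \<in> borel_measurable borel"
          by (rule borel_measurable_continuous_onI) (rule smooth_periodic_continuous[OF \<phi>])
        have [measurable]: "(\<lambda>x. indicator {0..T} x *\<^sub>R g x) \<in> borel_measurable lborel"
          using that unfolding set_integrable_def by (rule borel_measurable_integrable)
        have "(\<lambda>x. (indicator {0..T} x *\<^sub>R g x) * \<phi> x) \<in> borel_measurable lborel" by measurable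
        then show "(\<lambda>x. indicator {0..T} x *\<^sub>R (g x * \<phi> x)) \<in> borel_measurable lborel" by simp
        show "AE x in lborel. norm (indicator {0..T} x *\<^sub>R (g x * \<phi> x)) \<le> norm (M *\<^sub>R (indicator {0..T} x *\<^sub>R g x))"
        proof (rule AE_I2)
          fix x
          have "norm (g x) * norm (\<phi> x) \<le> \<bar>M\<bar> * norm (g x)" if "x \<in> {0..T}"
            using M[OF that] mult_left_mono[of "norm (\<phi> x)" "\<bar>M\<bar>" "norm (g x)"] by (simp add: mult.commute)
          then show "norm (indicator {0..T} x *\<^sub>R (g x * \<phi> x)) \<le> norm (M *\<^sub>R (indicator {0..T} x *\<^sub>R g x))"
            by (auto simp: indicator_def norm_mult)
        qed
      qed
    qed
    have "(LINT x:{0..T}|lborel. (g1 x - g2 x) * \<phi> x) =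
        (LINT x:{0..T}|lborel. g1 x * \<phi> x) - (LINT x:{0..T}|lborel. g2 x * \<phi> x)"
      unfolding left_diff_distrib by (rule set_integral_diff) (intro p i)+
    also have "\<dots> = 0" using w \<phi> unfolding weak_deriv_def by (metis diff_self minus_equation_iff)
    finally show "(LINT x:{0..T}|lborel. (g1 x - g2 x) * \<phi> x) = 0" .
  qed
  then show ?thesis by simp
qed

text \<open>\<open>wderiv\<close> picks an arbitrary representative, so its result is smooth only up
  to a null set. Both the hypothesis on \<open>f\<close> and the conclusion are therefore
  almost-everywhere statements of the same kind, which lets the lemma be applied twice for the
  second derivative.\<close>

lemma wderiv_ae_eq:
  assumes T: "0 < T" and f: "AE x in lborel. x \<in> {0..T} \<longrightarrow> f x = F x" "f \<in> borel_measurable borel"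
    and F: "smooth_periodic T F" "smooth_periodic T F'" "\<And>x. (F has_vector_derivative F' x) (at x)"
  shows "wderiv T f \<in> L2_circle T" "AE x in lborel. x \<in> {0..T} \<longrightarrow> wderiv T f x = F' x"
proof -
  have [measurable]: "F \<in> borel_measurable borel" "f \<in> borel_measurable borel"
    using f(2) smooth_periodic_L2[OF F(1)] by (auto simp: L2_circle_def)
  have W: "weak_deriv T F F'" using smooth_periodic_weak_deriv[OF _ F(1,2)] F(3) T by simp
  have "weak_deriv T f F'"
    unfolding weak_deriv_def
  proof (intro allI impI)
    fix \<phi> assume \<phi>: "smooth_periodic T \<phi>"
    obtain \<phi>' where \<phi>': "smooth_periodic T \<phi>'" "\<And>x. (\<phi> has_vector_derivative \<phi>' x) (at x)"
      using smooth_periodicD[OF \<phi>] by blast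
    have d: "vector_derivative \<phi> (at x) = \<phi>' x" for x by (rule vector_derivative_at) (rule \<phi>')
    have [measurable]: "\<phi>' \<in> borel_measurable borel"
      by (rule borel_measurable_continuous_onI) (rule smooth_periodic_continuous[OF \<phi>'(1)])
    have "(LINT x:{0..T}|lborel. f x * \<phi>' x) = (LINT x:{0..T}|lborel. F x * \<phi>' x)"
      unfolding set_lebesgue_integral_def
    proof (rule integral_cong_AE)
      show "AE x in lborel. indicator {0..T} x *\<^sub>R (f x * \<phi>' x) = indicator {0..T} x *\<^sub>R (F x * \<phi>' x)"
        using f(1) by eventually_elim (auto simp: indicator_def)
    qed measurable
    moreover have "(LINT x:{0..T}|lborel. F x * vector_derivative \<phi> (at x)) = - (LINT x:{0..T}|lborel. F' x * \<phi> x)"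
      using W \<phi> unfolding weak_deriv_def by blast
    ultimately show "(LINT x:{0..T}|lborel. f x * vector_derivative \<phi> (at x)) = - (LINT x:{0..T}|lborel. F' x * \<phi> x)"
      unfolding d by simp
  qed
  moreover have F'L: "F' \<in> L2_circle T" by (rule smooth_periodic_L2) (rule F)
  ultimately have *: "wderiv T f \<in> L2_circle T \<and> weak_deriv T f (wderiv T f)"
    unfolding wderiv_def by (intro someI[of "\<lambda>g. g \<in> L2_circle T \<and> weak_deriv T f g" F'] conjI)
  then show "wderiv T f \<in> L2_circle T" by simp
  show "AE x in lborel. x \<in> {0..T} \<longrightarrow> wderiv T f x = F' x"
    using weak_deriv_unique[OF T] * F'L \<open>weak_deriv T f F'\<close> by blast
qed

section \<open>Trigonometric polynomials and the linearized operator\<close>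

text \<open>The kernel of the Hartley transform. It keeps the coefficients of real functions real,
  and a product with cosine or sine is still a combination of just two kernels, so the linearization
  becomes a real matrix without separating parities.\<close>

definition cas :: "real \<Rightarrow> real" where
  "cas x = cos x + sin x"

lemma cos_times_cas: "cos t * cas a = (cas (a + t) + cas (a - t)) / 2"
  and sin_times_cas: "sin t * cas a = (cas (t - a) - cas (- t - a)) / 2"
  by (simp_all add: cas_def cos_add sin_add cos_diff sin_diff algebra_simps)

definition trig :: "int \<Rightarrow> (int \<Rightarrow> real) \<Rightarrow> real \<Rightarrow> real" where
  "trig N c x = (\<Sum>m\<in>{- N..N}. c m * cas (2 * of_int m * x))"

text \<open>Differentiating \<open>cas (2 * m * x)\<close> gives 2 m times the kernel of frequency
  -2 m, so the coefficients are reflected as well as multiplied.\<close>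

definition trig_deriv :: "(int \<Rightarrow> real) \<Rightarrow> int \<Rightarrow> real" where
  "trig_deriv c m = - (2 * of_int m * c (- m))"

lemma trig_extend:
  assumes "\<And>m. m \<notin> {- N..N} \<Longrightarrow> c m = 0" "N \<le> M"
  shows "trig M c = trig N c"
  unfolding trig_def by (rule ext, rule sum.mono_neutral_right) (use assms in auto)

lemma has_derivative_trig: "(trig N c has_real_derivative trig N (trig_deriv c) x) (at x)"
proof -
  have "(trig N c has_real_derivative
      (\<Sum>m\<in>{- N..N}. c m * (2 * of_int m * (cos (2 * of_int m * x) - sin (2 * of_int m * x))))) (at x)"
    unfolding trig_def[abs_def] cas_def
    by (auto intro!: derivative_eq_intros sum.cong simp: algebra_simps)
  also have "(\<Sum>m\<in>{- N..N}. c m * (2 * of_int m * (cos (2 * of_int m * x) - sin (2 * of_int m * x)))) =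
      trig N (trig_deriv c) x"
    unfolding trig_def
    by (rule sum.reindex_bij_witness[of _ uminus uminus]) (auto simp: trig_deriv_def cas_def)
  finally show ?thesis .
qed

lemma cas_periodic: "cas (2 * of_int m * (x + 2 * pi * real n)) = cas (2 * of_int m * x)"
proof -
  have "2 * of_int m * (x + 2 * pi * real n) = 2 * of_int m * x + 2 * pi * of_int (2 * m * int n)"
    by (simp add: algebra_simps)
  then show ?thesis unfolding cas_def
    by (metis cos_add cos_int_2pin sin_add sin_int_2pin mult.right_neutral mult_zero_right add.right_neutral diff_zero)
qed

lemma smooth_periodic_trig: "smooth_periodic (2 * pi * real n) (\<lambda>x. of_real (trig N c x))"
  unfolding smooth_periodic_def
proof (intro conjI allI exI[of _ "\<lambda>j x. of_real (trig N ((trig_deriv ^^ j) c) x)"])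
  fix j x
  show "((\<lambda>x. complex_of_real (trig N ((trig_deriv ^^ j) c) x)) has_vector_derivative
      of_real (trig N ((trig_deriv ^^ Suc j) c) x)) (at x)"
    using has_derivative_trig[of N "(trig_deriv ^^ j) c" x]
    by (simp add: has_vector_derivative_of_real has_real_derivative_iff_has_vector_derivative)
qed (simp_all add: trig_def cas_periodic)

lemma trig_vector_derivative:
  "((\<lambda>x. complex_of_real (trig N c x)) has_vector_derivative of_real (trig N (trig_deriv c) x)) (at x)"
  using has_derivative_trig[of N c x]
  by (simp add: has_vector_derivative_of_real has_real_derivative_iff_has_vector_derivative)

lemma trig_borel[measurable]: "trig N c \<in> borel_measurable borel"
  by (rule borel_measurable_continuous_onI)
    (auto simp: trig_def[abs_def] cas_def intro!: continuous_intros)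

lemma wderiv2_trig:
  fixes n :: nat and N c
  defines "T \<equiv> 2 * pi * real n" and "f \<equiv> \<lambda>x. complex_of_real (trig N c x)"
  assumes n: "1 \<le> n"
  shows "wderiv T (wderiv T f) \<in> L2_circle T"
    and "AE x in lborel. x \<in> {0..T} \<longrightarrow>
      wderiv T (wderiv T f) x = of_real (trig N (\<lambda>m. - (4 * (of_int m)\<^sup>2 * c m)) x)"
proof -
  have T: "0 < T" using n by (simp add: T_def)
  note s = smooth_periodic_trig[of n, folded T_def]
  have fm: "f \<in> borel_measurable borel" unfolding f_def by measurable
  have 1: "wderiv T f \<in> L2_circle T"
     "AE x in lborel. x \<in> {0..T} \<longrightarrow> wderiv T f x = of_real (trig N (trig_deriv c) x)"
    using wderiv_ae_eq[OF T _ fm s s trig_vector_derivative, of N c] by (simp_all add: f_def)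
  have dd: "trig_deriv (trig_deriv c) = (\<lambda>m. - (4 * (of_int m)\<^sup>2 * c m))"
    by (rule ext) (simp add: trig_deriv_def power2_eq_square)
  have m: "wderiv T f \<in> borel_measurable borel" using 1(1) by (simp add: L2_circle_def)
  show "wderiv T (wderiv T f) \<in> L2_circle T"
     "AE x in lborel. x \<in> {0..T} \<longrightarrow>
      wderiv T (wderiv T f) x = of_real (trig N (\<lambda>m. - (4 * (of_int m)\<^sup>2 * c m)) x)"
    using wderiv_ae_eq[OF T 1(2) m s s trig_vector_derivative] unfolding dd by auto
qed

section \<open>Orthogonality over whole periods\<close>

lemma integral_full_period:
  fixes l :: int and n :: nat
  shows "(LINT x:{0..2 * pi * real n}|lborel. cos (of_int l * x)) = (if l = 0 then 2 * pi * real n else 0)"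
    and "(LINT x:{0..2 * pi * real n}|lborel. sin (of_int l * x)) = 0"
proof -
  let ?T = "2 * pi * real n"
  have T: "0 \<le> ?T" by simp
  have p: "sin (of_int l * ?T) = 0" "cos (of_int l * ?T) = 1"
  proof -
    have "of_int l * ?T = 2 * pi * of_int (l * int n)" by simp
    then show "sin (of_int l * ?T) = 0" "cos (of_int l * ?T) = 1"
      by (simp_all only: sin_int_2pin cos_int_2pin)
  qed
  have c: "(LINT x:{0..?T}|lborel. cos (of_int l * x)) = sin (of_int l * ?T) / of_int l - sin (of_int l * 0) / of_int l" if "l \<noteq> 0"
    unfolding set_lebesgue_integral_def
    by (rule integral_FTC_atLeastAtMost[OF T])
      (use that in \<open>auto intro!: continuous_intros derivative_eq_intros has_vector_derivative_at_within
        simp flip: has_real_derivative_iff_has_vector_derivative\<close>)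
  have s: "(LINT x:{0..?T}|lborel. sin (of_int l * x)) = - cos (of_int l * ?T) / of_int l - (- cos (of_int l * 0) / of_int l)" if "l \<noteq> 0"
    unfolding set_lebesgue_integral_def
    by (rule integral_FTC_atLeastAtMost[OF T])
      (use that in \<open>auto intro!: continuous_intros derivative_eq_intros has_vector_derivative_at_within
        simp flip: has_real_derivative_iff_has_vector_derivative\<close>)
  show "(LINT x:{0..?T}|lborel. cos (of_int l * x)) = (if l = 0 then ?T else 0)"
    using c p by (cases "l = 0") (simp_all add: set_lebesgue_integral_def)
  show "(LINT x:{0..?T}|lborel. sin (of_int l * x)) = 0"
    using s p by (cases "l = 0") (simp_all add: set_lebesgue_integral_def)
qed

text \<open>Since cas a cas b = cos (a - b) + sin (a + b), only equal frequencies survive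
  integration. Every mode, the constant included, has squared norm equal to the period, so no
  separate weight for m = 0 appears.\<close>

lemma parseval_trig:
  fixes n :: nat
  shows "(LINT x:{0..2 * pi * real n}|lborel. (norm (complex_of_real (trig N c x)))\<^sup>2) =
     2 * pi * real n * (\<Sum>m\<in>{- N..N}. (c m)\<^sup>2)"
proof -
  let ?T = "2 * pi * real n"
  have ci: "set_integrable lborel {0..?T} (\<lambda>x. cos (of_int l * x))" 
    and si: "set_integrable lborel {0..?T} (\<lambda>x. sin (of_int l * x))" for l :: int
    by (auto intro!: borel_integrable_atLeastAtMost' continuous_intros)
  have prod: "cas (2 * of_int m * x) * cas (2 * of_int l * x) =
      cos (of_int (2 * (m - l)) * x) + sin (of_int (2 * (m + l)) * x)" for m l x
  proof -
    have "cas a * cas b = cos (a - b) + sin (a + b)" for a b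
      by (simp add: cas_def cos_diff sin_add algebra_simps)
    moreover have "of_int (2 * (m - l)) * x = 2 * of_int m * x - 2 * of_int l * x"
      "of_int (2 * (m + l)) * x = 2 * of_int m * x + 2 * of_int l * x"
      by (simp_all add: algebra_simps)
    ultimately show ?thesis by simp
  qed
  define G :: "int \<Rightarrow> int \<Rightarrow> real \<Rightarrow> real" where "G m l x = cos (of_int (2 * (m - l)) * x) + sin (of_int (2 * (m + l)) * x)" for m l x
  have Gi: "integrable lborel (\<lambda>x. indicator {0..?T} x *\<^sub>R G m l x)" for m l
    unfolding G_def set_integrable_def[symmetric] by (rule set_integral_add[OF ci si])
  have G: "(LINT x|lborel. indicator {0..?T} x *\<^sub>R G m l x) = (if m = l then ?T else 0)" for m l
    unfolding G_def set_lebesgue_integral_def[symmetric]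
    by (subst set_integral_add(2)[OF ci si]) (simp only: integral_full_period, simp)
  have "indicator {0..?T} x *\<^sub>R (norm (complex_of_real (trig N c x)))\<^sup>2 =
      (\<Sum>m\<in>{- N..N}. \<Sum>l\<in>{- N..N}. c m * c l * (indicator {0..?T} x *\<^sub>R G m l x))" for x
    unfolding G_def prod[symmetric] trig_def norm_of_real power2_abs
    by (simp add: power2_eq_square sum_product sum_distrib_left algebra_simps)
  then have "(LINT x:{0..?T}|lborel. (norm (complex_of_real (trig N c x)))\<^sup>2) =
     (LINT x|lborel. (\<Sum>m\<in>{- N..N}. \<Sum>l\<in>{- N..N}. c m * c l * (indicator {0..?T} x *\<^sub>R G m l x)))"
    unfolding set_lebesgue_integral_def by presburger
  also have "\<dots> = (\<Sum>m\<in>{- N..N}. LINT x|lborel. (\<Sum>l\<in>{- N..N}. c m * c l * (indicator {0..?T} x *\<^sub>R G m l x)))"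
    by (intro Bochner_Integration.integral_sum Bochner_Integration.integrable_sum integrable_mult_right Gi)
  also have "\<dots> = (\<Sum>m\<in>{- N..N}. \<Sum>l\<in>{- N..N}. LINT x|lborel. c m * c l * (indicator {0..?T} x *\<^sub>R G m l x))"
    by (intro sum.cong refl Bochner_Integration.integral_sum integrable_mult_right Gi)
  also have "\<dots> = (\<Sum>m\<in>{- N..N}. \<Sum>l\<in>{- N..N}. c m * c l * (if m = l then ?T else 0))"
    unfolding integral_mult_right_zero G ..
  also have "\<dots> = ?T * (\<Sum>m\<in>{- N..N}. (c m)\<^sup>2)"
    by (simp add: sum_distrib_left power2_eq_square if_distrib algebra_simps cong: if_cong)
  finally show ?thesis .
qed

section \<open>Convolution as a Fourier multiplier\<close>

lemma fourier_even_kernel: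
  assumes "admissible_kernel \<zeta>"
  shows "Re (fourier \<zeta> s) = (LINT x|lborel. \<zeta> x * cos (s * x))"
    and "(LINT x|lborel. \<zeta> x * sin (s * x)) = 0"
    and "integrable lborel (\<lambda>x. \<zeta> x * cos (s * x))" "integrable lborel (\<lambda>x. \<zeta> x * sin (s * x))"
    and "Re (fourier \<zeta> (- s)) = Re (fourier \<zeta> s)"
    and "0 < Re (fourier \<zeta> s)" "Re (fourier \<zeta> s) \<le> 1" "Re (fourier \<zeta> 0) = 1"
proof -
  have i: "integrable lborel \<zeta>" and even: "\<And>x. \<zeta> (- x) = \<zeta> x" and nn: "\<And>x. 0 \<le> \<zeta> x"
    and one: "(LINT x|lborel. \<zeta> x) = 1"
    using assms by (auto simp: admissible_kernel_def)
  have [measurable]: "\<zeta> \<in> borel_measurable lborel" using i by (rule borel_measurable_integrable)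
  show c: "integrable lborel (\<lambda>x. \<zeta> x * cos (s * x))" for s
    by (rule Bochner_Integration.integrable_bound[OF i]) (auto simp: abs_mult nn mult_left_le)
  show "integrable lborel (\<lambda>x. \<zeta> x * sin (s * x))"
    by (rule Bochner_Integration.integrable_bound[OF i]) (auto simp: abs_mult nn mult_left_le)
  have ce: "integrable lborel (\<lambda>x. exp (- \<i> * of_real (s * x)) * of_real (\<zeta> x))" for s
    by (rule Bochner_Integration.integrable_bound[OF i]) (auto simp: norm_mult nn)
  show re: "Re (fourier \<zeta> s) = (LINT x|lborel. \<zeta> x * cos (s * x))" for s
    unfolding fourier_def by (subst integral_Re[OF ce, symmetric]) (simp add: Re_exp mult.commute)
  show "(LINT x|lborel. \<zeta> x * sin (s * x)) = 0"
    using lborel_integral_real_affine[of "-1" "\<lambda>x. \<zeta> x * sin (s * x)" 0] even by simp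
  show "Re (fourier \<zeta> (- s)) = Re (fourier \<zeta> s)" unfolding re by simp
  show "0 < Re (fourier \<zeta> s)" using assms by (auto simp: admissible_kernel_def)
  have "(LINT x|lborel. \<zeta> x * cos (s * x)) \<le> (LINT x|lborel. \<zeta> x)"
    by (rule integral_mono[OF c i]) (simp add: nn mult_left_le)
  then show "Re (fourier \<zeta> s) \<le> 1" unfolding re one .
  show "Re (fourier \<zeta> 0) = 1" unfolding re using one by simp
qed

lemma fourier_near_zero:
  assumes "admissible_kernel \<zeta>" "c < 1"
  shows "\<exists>d>0. \<forall>s. \<bar>s\<bar> < d \<longrightarrow> c < Re (fourier \<zeta> s)"
proof -
  have i: "integrable lborel \<zeta>" and nn: "\<And>x. 0 \<le> \<zeta> x"
    using assms by (auto simp: admissible_kernel_def)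
  have [measurable]: "\<zeta> \<in> borel_measurable lborel" using i by (rule borel_measurable_integrable)
  have "((\<lambda>s. Re (fourier \<zeta> s)) \<longlongrightarrow> Re (fourier \<zeta> 0)) (at 0)"
    unfolding fourier_even_kernel(1)[OF assms(1)] tendsto_at_iff_sequentially o_def
  proof (intro allI impI)
    fix X :: "nat \<Rightarrow> real" assume X: "X \<longlonglongrightarrow> 0"
    show "(\<lambda>n. LINT x|lborel. \<zeta> x * cos (X n * x)) \<longlonglongrightarrow> (LINT x|lborel. \<zeta> x * cos (0 * x))"
    proof (rule integral_dominated_convergence[where w = \<zeta>])
      show "AE x in lborel. (\<lambda>n. \<zeta> x * cos (X n * x)) \<longlonglongrightarrow> \<zeta> x * cos (0 * x)"
        by (intro AE_I2 tendsto_intros X)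
    qed (use nn i in \<open>auto simp: abs_mult mult_left_le\<close>)
  qed
  then have "\<forall>\<^sub>F s in at 0. c < Re (fourier \<zeta> s)"
    by (rule order_tendstoD) (simp only: fourier_even_kernel(8)[OF assms(1)] assms(2))
  then obtain d where "0 < d" "\<And>s. s \<noteq> 0 \<Longrightarrow> \<bar>s\<bar> < d \<Longrightarrow> c < Re (fourier \<zeta> s)"
    unfolding eventually_at by (auto simp: dist_real_def)
  then show ?thesis using fourier_even_kernel(8)[OF assms(1)] assms(2) by metis
qed

text \<open>Substituting y = x - k \<epsilon> t turns the rescaled kernel back into \<zeta>;
  evenness of \<zeta> removes the sine part, so each kernel \<open>cas\<close> is an eigenfunction.
  The delta case fits the same formula because the transform equals 1 at 0.\<close>

lemma conv_rkern_trig: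
  assumes adm: "admissible_kernel \<zeta>" and "0 < k" "0 \<le> \<epsilon>"
  shows "conv_rkern \<zeta> k \<epsilon> (\<lambda>x. of_real (\<Sum>j\<in>S. q j * cas (\<omega> j * x))) x =
    of_real (\<Sum>j\<in>S. Re (fourier \<zeta> (k * \<epsilon> * \<omega> j)) * q j * cas (\<omega> j * x))"
proof (cases "\<epsilon> = 0")
  case True
  then show ?thesis using fourier_even_kernel(8)[OF adm] by (simp add: conv_rkern_def)
next
  case False
  define c where "c = k * \<epsilon>"
  have c: "0 < c" using False assms by (simp add: c_def)
  have rk: "rkern \<zeta> k \<epsilon> (c * t) = \<zeta> t / c" for t
    using False assms by (simp add: rkern_def kern_def c_def field_simps)
  let ?g = "\<lambda>y. \<Sum>j\<in>S. q j * cas (\<omega> j * y)"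
  have cas_diff: "cas (a - b) = cas a * cos b + (sin a - cos a) * sin b" for a b
    by (simp add: cas_def cos_diff sin_diff algebra_simps)
  note fk = fourier_even_kernel[OF adm]
  have "(LINT y|lborel. rkern \<zeta> k \<epsilon> (x - y) * ?g y) =
      \<bar>- c\<bar> * (LINT t|lborel. rkern \<zeta> k \<epsilon> (x - (x + - c * t)) * ?g (x + - c * t))"
    using lborel_integral_real_affine[of "- c" "\<lambda>y. rkern \<zeta> k \<epsilon> (x - y) * ?g y" x] c by simp
  also have "\<dots> = (LINT t|lborel. c * (rkern \<zeta> k \<epsilon> (c * t) * ?g (x - c * t)))"
    using c by simp
  also have "\<dots> = (LINT t|lborel. (\<Sum>j\<in>S. q j * (cas (\<omega> j * x) * (\<zeta> t * cos (c * \<omega> j * t)) +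
      (sin (\<omega> j * x) - cos (\<omega> j * x)) * (\<zeta> t * sin (c * \<omega> j * t)))))"
  proof (rule Bochner_Integration.integral_cong[OF refl])
    fix t
    have "cas (\<omega> j * (x - c * t)) = cas (\<omega> j * x) * cos (c * \<omega> j * t) +
      (sin (\<omega> j * x) - cos (\<omega> j * x)) * sin (c * \<omega> j * t)" for j
      unfolding cas_diff[symmetric] by (simp add: algebra_simps)
    note e = this
    show "c * (rkern \<zeta> k \<epsilon> (c * t) * ?g (x - c * t)) = (\<Sum>j\<in>S. q j * (cas (\<omega> j * x) * (\<zeta> t * cos (c * \<omega> j * t)) +
      (sin (\<omega> j * x) - cos (\<omega> j * x)) * (\<zeta> t * sin (c * \<omega> j * t))))"
      unfolding rk e using c by (simp add: sum_distrib_left algebra_simps)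
  qed
  also have "\<dots> = (\<Sum>j\<in>S. q j * (cas (\<omega> j * x) * Re (fourier \<zeta> (c * \<omega> j))))"
    using fk(2-4) unfolding fk(1) by (simp add: Bochner_Integration.integral_add)
  finally have "(LINT y|lborel. rkern \<zeta> k \<epsilon> (x - y) * ?g y) =
      (\<Sum>j\<in>S. Re (fourier \<zeta> (k * \<epsilon> * \<omega> j)) * q j * cas (\<omega> j * x))"
    by (simp add: c_def algebra_simps)
  moreover have "conv_rkern \<zeta> k \<epsilon> (\<lambda>x. of_real (?g x)) x = of_real (LINT y|lborel. rkern \<zeta> k \<epsilon> (x - y) * ?g y)"
    using False unfolding conv_rkern_def by (simp only: if_False integral_complex_of_real[symmetric] of_real_mult)
  ultimately show ?thesis by simp
qed

section \<open>Products with cosine and sine: between even and odd frequencies\<close>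

lemma cos_times_trig:
  assumes w: "\<And>m. m \<notin> {- N..N} \<Longrightarrow> w m = 0"
  shows "cos t * trig N w t = (\<Sum>j\<in>{- N - 1..N}. (w j + w (j + 1)) / 2 * cas ((2 * of_int j + 1) * t))"
proof -
  let ?o = "\<lambda>j. cas ((2 * of_int j + 1) * t)"
  have "cos t * trig N w t = (\<Sum>m\<in>{- N..N}. w m / 2 * ?o m) + (\<Sum>m\<in>{- N..N}. w m / 2 * ?o (m - 1))"
    unfolding trig_def sum_distrib_left sum.distrib[symmetric]
  proof (rule sum.cong[OF refl])
    fix m
    have "cos t * cas (2 * of_int m * t) = (?o m + ?o (m - 1)) / 2"
      unfolding cos_times_cas by (simp add: algebra_simps)
    note e = this
    show "cos t * (w m * cas (2 * of_int m * t)) = w m / 2 * ?o m + w m / 2 * ?o (m - 1)"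
      unfolding mult.left_commute[of "cos t" "w m"] e
      by (simp add: ring_distribs add_divide_distrib diff_divide_distrib)
  qed
  also have "(\<Sum>m\<in>{- N..N}. w m / 2 * ?o m) = (\<Sum>j\<in>{- N - 1..N}. w j / 2 * ?o j)"
    by (rule sum.mono_neutral_left) (use w in auto)
  also have "(\<Sum>m\<in>{- N..N}. w m / 2 * ?o (m - 1)) = (\<Sum>j\<in>{- N - 1..N}. w (j + 1) / 2 * ?o j)"
    by (rule trans[OF sum_reindex_support[OF bij_int_shift[of 1], of "{- N..N}" "{- N - 1..N}"
      "\<lambda>m. w m / 2 * ?o (m - 1)", symmetric]]) (use w in auto)
  finally show ?thesis by (simp add: sum.distrib[symmetric] add_divide_distrib distrib_right)
qed

lemma sin_times_trig:
  assumes z: "\<And>m. m \<notin> {- N..N} \<Longrightarrow> z m = 0"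
  shows "sin t * trig N z t = (\<Sum>j\<in>{- N - 1..N}. (z (- j) - z (- j - 1)) / 2 * cas ((2 * of_int j + 1) * t))"
proof -
  let ?o = "\<lambda>j. cas ((2 * of_int j + 1) * t)"
  have flip: "- m - 1 = - 1 - m" for m :: int by simp
  have "sin t * trig N z t = (\<Sum>m\<in>{- N..N}. z m / 2 * ?o (- m)) - (\<Sum>m\<in>{- N..N}. z m / 2 * ?o (- m - 1))"
    unfolding trig_def sum_distrib_left sum_subtractf[symmetric]
  proof (rule sum.cong[OF refl])
    fix m
    have "sin t * cas (2 * of_int m * t) = (?o (- m) - ?o (- m - 1)) / 2"
      unfolding sin_times_cas by (simp add: algebra_simps)
    note e = this
    show "sin t * (z m * cas (2 * of_int m * t)) = z m / 2 * ?o (- m) - z m / 2 * ?o (- m - 1)"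
      unfolding mult.left_commute[of "sin t" "z m"] e
      by (simp add: ring_distribs add_divide_distrib diff_divide_distrib)
  qed
  also have "(\<Sum>m\<in>{- N..N}. z m / 2 * ?o (- m)) = (\<Sum>j\<in>{- N - 1..N}. z (- j) / 2 * ?o j)"
    by (rule trans[OF sum_reindex_support[OF bij_int_flip[of 0], of "{- N - 1..N}" "{- N..N}"
      "\<lambda>j. z (- j) / 2 * ?o j", symmetric], symmetric]) (use z in auto)
  also have "(\<Sum>m\<in>{- N..N}. z m / 2 * ?o (- m - 1)) = (\<Sum>j\<in>{- N - 1..N}. z (- j - 1) / 2 * ?o j)"
    by (rule trans[OF sum_reindex_support[OF bij_int_flip[of "- 1"], of "{- N - 1..N}" "{- N..N}"
      "\<lambda>j. z (- j - 1) / 2 * ?o j", symmetric], symmetric]) (use z in \<open>auto simp: flip\<close>)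
  finally show ?thesis by (simp add: sum_subtractf[symmetric] diff_divide_distrib left_diff_distrib)
qed

lemma cos_times_odd:
  assumes q: "\<And>j. j \<notin> {- N - 1..N} \<Longrightarrow> q j = 0"
  shows "2 * cos t * (\<Sum>j\<in>{- N - 1..N}. q j * cas ((2 * of_int j + 1) * t)) =
    trig (N + 1) (\<lambda>m. q (m - 1) + q m) t"
proof -
  let ?e = "\<lambda>m. cas (2 * of_int m * t)"
  have "2 * cos t * (\<Sum>j\<in>{- N - 1..N}. q j * cas ((2 * of_int j + 1) * t)) =
      (\<Sum>j\<in>{- N - 1..N}. q j * ?e (j + 1)) + (\<Sum>j\<in>{- N - 1..N}. q j * ?e j)"
    unfolding sum_distrib_left sum.distrib[symmetric]
  proof (rule sum.cong[OF refl])
    fix j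
    have "cos t * cas ((2 * of_int j + 1) * t) = (?e (j + 1) + ?e j) / 2"
      unfolding cos_times_cas by (simp add: algebra_simps)
    note e = this
    show "2 * cos t * (q j * cas ((2 * of_int j + 1) * t)) = q j * ?e (j + 1) + q j * ?e j"
      unfolding mult.left_commute[of "2 * cos t" "q j"] unfolding mult.assoc[of 2 "cos t"] e
      by (simp add: ring_distribs add_divide_distrib diff_divide_distrib)
  qed
  also have "(\<Sum>j\<in>{- N - 1..N}. q j * ?e j) = (\<Sum>m\<in>{- (N + 1)..N + 1}. q m * ?e m)"
    by (rule sum.mono_neutral_left) (use q in auto)
  also have "(\<Sum>j\<in>{- N - 1..N}. q j * ?e (j + 1)) = (\<Sum>m\<in>{- (N + 1)..N + 1}. q (m - 1) * ?e m)"
    by (rule trans[OF sum_reindex_support[OF bij_int_shift[of "- 1"], of "{- N - 1..N}" "{- (N + 1)..N + 1}"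
      "\<lambda>j. q j * ?e (j + 1)", symmetric]]) (use q in auto)
  finally show ?thesis unfolding trig_def by (simp add: sum.distrib[symmetric] distrib_right)
qed

lemma sin_times_odd:
  assumes q: "\<And>j. j \<notin> {- N - 1..N} \<Longrightarrow> q j = 0"
  shows "2 * sin t * (\<Sum>j\<in>{- N - 1..N}. q j * cas ((2 * of_int j + 1) * t)) =
    trig (N + 1) (\<lambda>m. q (- m) - q (- m - 1)) t"
proof -
  let ?e = "\<lambda>m. cas (2 * of_int m * t)"
  have flip: "- m - 1 = - 1 - m" for m :: int by simp
  have "2 * sin t * (\<Sum>j\<in>{- N - 1..N}. q j * cas ((2 * of_int j + 1) * t)) =
      (\<Sum>j\<in>{- N - 1..N}. q j * ?e (- j)) - (\<Sum>j\<in>{- N - 1..N}. q j * ?e (- j - 1))"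
    unfolding sum_distrib_left sum_subtractf[symmetric]
  proof (rule sum.cong[OF refl])
    fix j
    have "t - (2 * of_int j + 1) * t = 2 * of_int (- j) * t" "- t - (2 * of_int j + 1) * t = 2 * of_int (- j - 1) * t"
      by (simp_all add: algebra_simps)
    then have "sin t * cas ((2 * of_int j + 1) * t) = (?e (- j) - ?e (- j - 1)) / 2"
      unfolding sin_times_cas by simp
    note e = this
    show "2 * sin t * (q j * cas ((2 * of_int j + 1) * t)) = q j * ?e (- j) - q j * ?e (- j - 1)"
      unfolding mult.left_commute[of "2 * sin t" "q j"] unfolding mult.assoc[of 2 "sin t"] e
      by (simp add: ring_distribs add_divide_distrib diff_divide_distrib)
  qed
  also have "(\<Sum>j\<in>{- N - 1..N}. q j * ?e (- j)) = (\<Sum>m\<in>{- (N + 1)..N + 1}. q (- m) * ?e m)"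
    by (rule trans[OF sum_reindex_support[OF bij_int_flip[of 0], of "{- N - 1..N}" "{- (N + 1)..N + 1}"
      "\<lambda>j. q j * ?e (- j)", symmetric]]) (use q in auto)
  also have "(\<Sum>j\<in>{- N - 1..N}. q j * ?e (- j - 1)) = (\<Sum>m\<in>{- (N + 1)..N + 1}. q (- m - 1) * ?e m)"
    by (rule trans[OF sum_reindex_support[OF bij_int_flip[of "- 1"], of "{- N - 1..N}" "{- (N + 1)..N + 1}"
      "\<lambda>j. q j * ?e (- j - 1)", symmetric]]) (use q in \<open>auto simp: flip\<close>)
  finally show ?thesis unfolding trig_def by (simp add: sum_subtractf[symmetric] left_diff_distrib)
qed

section \<open>The linearized operator on trigonometric polynomials\<close>

lemma trig_add: "trig N (\<lambda>m. c m + d m) t = trig N c t + trig N d t"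
  and trig_scale: "trig N (\<lambda>m. r * c m) t = r * trig N c t"
  by (simp_all add: trig_def sum.distrib distrib_right sum_distrib_left mult.assoc)

definition trig_pair :: "int \<Rightarrow> (int + int \<Rightarrow> real) \<Rightarrow> cfun2" where
  "trig_pair N x = (\<lambda>t. of_real (trig N (\<lambda>m. x (Inl m)) t), \<lambda>t. of_real (trig N (\<lambda>m. x (Inr m)) t))"

text \<open>Two multiplications by cosine or sine raise the largest frequency by 2, hence the level
  N + 1. Since the image is identified only up to a null set, its measurability is recorded
  separately for the integrals that follow.\<close>

lemma L_op_trig_pair:
  fixes \<zeta> :: "real \<Rightarrow> real" and n :: nat and k \<epsilon> A B :: real and x :: "int + int \<Rightarrow> real"
  defines "T \<equiv> 2 * pi * real n"
    and "Lx \<equiv> L_coeff (k\<^sup>2 / 2) (sqrt B) (sqrt (B + A)) (\<lambda>j. Re (fourier \<zeta> (k * \<epsilon> * (2 * of_int j + 1)))) x"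
  assumes adm: "admissible_kernel \<zeta>" and k: "0 < k" and \<epsilon>: "0 \<le> \<epsilon>" and n: "1 \<le> n"
    and x: "\<forall>i. i \<notin> modes N \<longrightarrow> x i = 0"
  shows "fst (L_op \<zeta> k \<epsilon> A B T (trig_pair N x)) \<in> borel_measurable borel"
    and "snd (L_op \<zeta> k \<epsilon> A B T (trig_pair N x)) \<in> borel_measurable borel"
    and "AE t in lborel. t \<in> {0..T} \<longrightarrow>
      fst (L_op \<zeta> k \<epsilon> A B T (trig_pair N x)) t = of_real (trig (N + 1) (\<lambda>m. Lx (Inl m)) t) \<and>
      snd (L_op \<zeta> k \<epsilon> A B T (trig_pair N x)) t = of_real (trig (N + 1) (\<lambda>m. Lx (Inr m)) t)"
proof -
  define p s where "p = sqrt B" and "s = sqrt (B + A)"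
  define \<rho> where "\<rho> j = Re (fourier \<zeta> (k * \<epsilon> * (2 * of_int j + 1)))" for j :: int
  let ?w = "\<lambda>m. x (Inl m)" and ?z = "\<lambda>m. x (Inr m)"
  define W Z where "W = (\<lambda>t. complex_of_real (trig N ?w t))" and "Z = (\<lambda>t. complex_of_real (trig N ?z t))"
  let ?q = "\<lambda>t. \<Sum>j\<in>{- N - 1..N}. \<rho> j * q_coeff p s x j * cas ((2 * of_int j + 1) * t)"
  have wz: "?w m = 0" "?z m = 0" if "m \<notin> {- N..N}" for m using x that modes_iff[of m N] by blast+
  have "of_real (u_omega B t) * W t + of_real (v_omega A B t) * Z t =
      of_real (\<Sum>j\<in>{- N - 1..N}. q_coeff p s x j * cas ((2 * of_int j + 1) * t))" for t
  proof -
    have "u_omega B t * trig N ?w t + v_omega A B t * trig N ?z t =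
        p * (cos t * trig N ?w t) + s * (sin t * trig N ?z t)"
      by (simp add: u_omega_def v_omega_def p_def s_def)
    also have "\<dots> = (\<Sum>j\<in>{- N - 1..N}. q_coeff p s x j * cas ((2 * of_int j + 1) * t))"
    proof -
      have c: "cos t * trig N ?w t = (\<Sum>j\<in>{- N - 1..N}. (?w j + ?w (j + 1)) / 2 * cas ((2 * of_int j + 1) * t))"
        by (rule cos_times_trig) (rule wz(1))
      have s: "sin t * trig N ?z t = (\<Sum>j\<in>{- N - 1..N}. (?z (- j) - ?z (- j - 1)) / 2 * cas ((2 * of_int j + 1) * t))"
        by (rule sin_times_trig) (rule wz(2))
      show ?thesis
        unfolding c s sum_distrib_left sum.distrib[symmetric] q_coeff_def
        by (rule sum.cong[OF refl]) (simp add: ring_distribs add_divide_distrib diff_divide_distrib)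
    qed
    finally show ?thesis unfolding W_def Z_def by (simp only: flip: of_real_mult of_real_add)
  qed
  then have conv: "conv_rkern \<zeta> k \<epsilon> (\<lambda>t. of_real (u_omega B t) * W t + of_real (v_omega A B t) * Z t) t =
      of_real (?q t)" for t
    unfolding \<rho>_def by (simp only: conv_rkern_trig[OF adm k \<epsilon>])
  have L_eq: "L_op \<zeta> k \<epsilon> A B T (trig_pair N x) =
     (\<lambda>t. - of_real (k\<^sup>2 / 2) * (wderiv T (wderiv T W) t + W t) + 2 * of_real (u_omega B t) * of_real (?q t),
      \<lambda>t. - of_real (k\<^sup>2 / 2) * (wderiv T (wderiv T Z) t + Z t) + 2 * of_real (v_omega A B t) * of_real (?q t))"
    unfolding L_op_def trig_pair_def W_def[symmetric] Z_def[symmetric] prod.case Let_def conv ..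
  have wd: "wderiv T (wderiv T W) \<in> borel_measurable borel" "wderiv T (wderiv T Z) \<in> borel_measurable borel"
    using wderiv2_trig(1)[OF n, of N] unfolding W_def Z_def T_def by (auto simp: L2_circle_def)
  have [measurable]: "W \<in> borel_measurable borel" "Z \<in> borel_measurable borel"
    unfolding W_def Z_def by measurable
  have [measurable]: "u_omega B \<in> borel_measurable borel" "v_omega A B \<in> borel_measurable borel"
    "cas \<in> borel_measurable borel"
    unfolding u_omega_def[abs_def] v_omega_def[abs_def] cas_def[abs_def] by measurable
  show "fst (L_op \<zeta> k \<epsilon> A B T (trig_pair N x)) \<in> borel_measurable borel"
    unfolding L_eq fst_conv using wd by measurable
  show "snd (L_op \<zeta> k \<epsilon> A B T (trig_pair N x)) \<in> borel_measurable borel"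
    unfolding L_eq snd_conv using wd by measurable
  have q0: "\<rho> j * q_coeff p s x j = 0" if "j \<notin> {- N - 1..N}" for j
  proof -
    have "j \<notin> {- N..N}" "j + 1 \<notin> {- N..N}" "- j \<notin> {- N..N}" "- j - 1 \<notin> {- N..N}" using that by auto
    then have "x (Inl j) = 0" "x (Inl (j + 1)) = 0" "x (Inr (- j)) = 0" "x (Inr (- j - 1)) = 0"
      by (simp_all add: wz del: atLeastAtMost_iff)
    then show ?thesis unfolding q_coeff_def by simp
  qed
  have Lx: "Lx = L_coeff (k\<^sup>2 / 2) p s \<rho> x"
    unfolding Lx_def p_def s_def \<rho>_def ..
  have ext: "trig N c = trig (N + 1) c" if "\<And>m. m \<notin> {- N..N} \<Longrightarrow> c m = 0" for c
    by (rule trig_extend[symmetric]) (use that in auto)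
  have w_eq: "- (k\<^sup>2 / 2) * (trig N (\<lambda>m. - (4 * (of_int m)\<^sup>2 * ?w m)) t + trig N ?w t) + 2 * u_omega B t * ?q t =
      trig (N + 1) (\<lambda>m. Lx (Inl m)) t" for t
  proof -
    have "2 * u_omega B t * ?q t = p * (2 * cos t * ?q t)"
      by (simp add: u_omega_def p_def)
    also have "2 * cos t * ?q t = trig (N + 1) (\<lambda>m. \<rho> (m - 1) * q_coeff p s x (m - 1) + \<rho> m * q_coeff p s x m) t"
      by (rule cos_times_odd) (rule q0)
    finally have "- (k\<^sup>2 / 2) * (trig N (\<lambda>m. - (4 * (of_int m)\<^sup>2 * ?w m)) t + trig N ?w t) + 2 * u_omega B t * ?q t =
      - (k\<^sup>2 / 2) * trig (N + 1) (\<lambda>m. - (4 * (of_int m)\<^sup>2 * ?w m) + ?w m) t +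
      p * trig (N + 1) (\<lambda>m. \<rho> (m - 1) * q_coeff p s x (m - 1) + \<rho> m * q_coeff p s x m) t"
      unfolding trig_add[symmetric] using ext[of "\<lambda>m. - (4 * (of_int m)\<^sup>2 * ?w m) + ?w m"] wz by simp
    also have "\<dots> = trig (N + 1) (\<lambda>m. Lx (Inl m)) t"
      unfolding trig_scale[symmetric] trig_add[symmetric] Lx L_coeff_def sum.case
      by (rule arg_cong[where f = "\<lambda>c. trig (N + 1) c t"]) (simp add: fun_eq_iff algebra_simps)
    finally show ?thesis .
  qed
  have z_eq: "- (k\<^sup>2 / 2) * (trig N (\<lambda>m. - (4 * (of_int m)\<^sup>2 * ?z m)) t + trig N ?z t) + 2 * v_omega A B t * ?q t =
      trig (N + 1) (\<lambda>m. Lx (Inr m)) t" for t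
  proof -
    have "2 * v_omega A B t * ?q t = s * (2 * sin t * ?q t)"
      by (simp add: v_omega_def s_def)
    also have "2 * sin t * ?q t = trig (N + 1) (\<lambda>m. \<rho> (- m) * q_coeff p s x (- m) - \<rho> (- m - 1) * q_coeff p s x (- m - 1)) t"
      by (rule sin_times_odd) (rule q0)
    finally have "- (k\<^sup>2 / 2) * (trig N (\<lambda>m. - (4 * (of_int m)\<^sup>2 * ?z m)) t + trig N ?z t) + 2 * v_omega A B t * ?q t =
      - (k\<^sup>2 / 2) * trig (N + 1) (\<lambda>m. - (4 * (of_int m)\<^sup>2 * ?z m) + ?z m) t +
      s * trig (N + 1) (\<lambda>m. \<rho> (- m) * q_coeff p s x (- m) - \<rho> (- m - 1) * q_coeff p s x (- m - 1)) t"
      unfolding trig_add[symmetric] using ext[of "\<lambda>m. - (4 * (of_int m)\<^sup>2 * ?z m) + ?z m"] wz by simp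
    also have "\<dots> = trig (N + 1) (\<lambda>m. Lx (Inr m)) t"
      unfolding trig_scale[symmetric] trig_add[symmetric] Lx L_coeff_def sum.case
      by (rule arg_cong[where f = "\<lambda>c. trig (N + 1) c t"]) (simp add: fun_eq_iff algebra_simps)
    finally show ?thesis .
  qed
  show "AE t in lborel. t \<in> {0..T} \<longrightarrow>
      fst (L_op \<zeta> k \<epsilon> A B T (trig_pair N x)) t = of_real (trig (N + 1) (\<lambda>m. Lx (Inl m)) t) \<and>
      snd (L_op \<zeta> k \<epsilon> A B T (trig_pair N x)) t = of_real (trig (N + 1) (\<lambda>m. Lx (Inr m)) t)"
    using wderiv2_trig(2)[OF n, of N ?w] wderiv2_trig(2)[OF n, of N ?z]
    unfolding T_def[symmetric] W_def[symmetric] Z_def[symmetric]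
  proof eventually_elim
    case (elim t)
    show ?case
      using elim unfolding L_eq fst_conv snd_conv w_eq[symmetric] z_eq[symmetric] W_def Z_def by simp
  qed
qed

lemma L2_norm2_trig_pair:
  fixes n :: nat
  shows "L2_norm2 (2 * pi * real n) (trig_pair N x) = sqrt (2 * pi * real n * (\<Sum>i\<in>modes N. (x i)\<^sup>2))"
  unfolding L2_norm2_def trig_pair_def fst_conv snd_conv parseval_trig sum_modes
  by (simp add: sum.distrib distrib_left)

lemma trig_pair_domain: "trig_pair N x \<in> sobolev s (2 * pi * real n) \<times> sobolev s (2 * pi * real n)"
  unfolding trig_pair_def by (auto intro!: smooth_periodic_sobolev smooth_periodic_trig)

text \<open>As J squares to -1, JL - \<mu> equals J (L + \<mu> J), and J is an isometry; so the norm
  is that of the residual \<open>Lx + \<mu> * J_coeff x\<close>.\<close>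

lemma L2_norm2_shifted_trig_pair:
  fixes \<zeta> :: "real \<Rightarrow> real" and n :: nat and k \<epsilon> A B :: real and x :: "int + int \<Rightarrow> real"
  defines "T \<equiv> 2 * pi * real n"
    and "Lx \<equiv> L_coeff (k\<^sup>2 / 2) (sqrt B) (sqrt (B + A)) (\<lambda>j. Re (fourier \<zeta> (k * \<epsilon> * (2 * of_int j + 1)))) x"
  assumes adm: "admissible_kernel \<zeta>" and k: "0 < k" and \<epsilon>: "0 \<le> \<epsilon>" and n: "1 \<le> n"
    and x: "\<forall>i. i \<notin> modes N \<longrightarrow> x i = 0"
  shows "L2_norm2 T (shifted (J_op \<circ> L_op \<zeta> k \<epsilon> A B T) (of_real \<mu>) (trig_pair N x)) =
    sqrt (T * (\<Sum>i\<in>modes (N + 1). (Lx i + \<mu> * J_coeff x i)\<^sup>2))"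
proof -
  let ?F = "L_op \<zeta> k \<epsilon> A B T (trig_pair N x)"
  note L = L_op_trig_pair[OF adm k \<epsilon> n x, where A = A and B = B, folded T_def Lx_def]
  let ?r = "\<lambda>i. Lx i + \<mu> * J_coeff x i"
  have wz: "x (Inl m) = 0" "x (Inr m) = 0" if "m \<notin> {- N..N}" for m using x that modes_iff[of m N] by blast+
  have ext: "trig N (\<lambda>m. x (Inl m)) = trig (N + 1) (\<lambda>m. x (Inl m))" "trig N (\<lambda>m. x (Inr m)) = trig (N + 1) (\<lambda>m. x (Inr m))"
    by (rule trig_extend[symmetric]; use wz in auto)+
  have S: "shifted (J_op \<circ> L_op \<zeta> k \<epsilon> A B T) (of_real \<mu>) (trig_pair N x) =
     (\<lambda>t. snd ?F t - of_real (\<mu> * trig N (\<lambda>m. x (Inl m)) t), \<lambda>t. - fst ?F t - of_real (\<mu> * trig N (\<lambda>m. x (Inr m)) t))"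
    unfolding shifted_def o_def J_op_def by (simp add: case_prod_beta trig_pair_def)
  have r_l: "trig (N + 1) (\<lambda>m. Lx (Inr m)) t - \<mu> * trig N (\<lambda>m. x (Inl m)) t = trig (N + 1) (\<lambda>m. ?r (Inr m)) t" for t
  proof -
    have "(\<lambda>m. ?r (Inr m)) = (\<lambda>m. Lx (Inr m) + (- \<mu>) * x (Inl m))"
      by (simp add: J_coeff_def fun_eq_iff)
    then show ?thesis by (simp only: ext trig_add trig_scale, simp?)
  qed
  have r_r: "- trig (N + 1) (\<lambda>m. Lx (Inl m)) t - \<mu> * trig N (\<lambda>m. x (Inr m)) t = - trig (N + 1) (\<lambda>m. ?r (Inl m)) t" for t
  proof -
    have "(\<lambda>m. ?r (Inl m)) = (\<lambda>m. Lx (Inl m) + \<mu> * x (Inr m))"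
      by (simp add: J_coeff_def fun_eq_iff)
    then show ?thesis by (simp only: ext trig_add trig_scale, simp?)
  qed
  have 1: "(LINT t:{0..T}|lborel. (norm (snd ?F t - of_real (\<mu> * trig N (\<lambda>m. x (Inl m)) t)))\<^sup>2) =
      (LINT t:{0..T}|lborel. (norm (complex_of_real (trig (N + 1) (\<lambda>m. ?r (Inr m)) t)))\<^sup>2)"
    unfolding set_lebesgue_integral_def
  proof (rule integral_cong_AE)
    show "AE t in lborel. indicator {0..T} t *\<^sub>R (norm (snd ?F t - of_real (\<mu> * trig N (\<lambda>m. x (Inl m)) t)))\<^sup>2 =
        indicator {0..T} t *\<^sub>R (norm (complex_of_real (trig (N + 1) (\<lambda>m. ?r (Inr m)) t)))\<^sup>2"
      using L(3)
    proof eventually_elim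
      case (elim t)
      then show ?case unfolding r_l[symmetric] by (auto simp: indicator_def)
    qed
  qed (use L(2) in measurable)
  have 2: "(LINT t:{0..T}|lborel. (norm (- fst ?F t - of_real (\<mu> * trig N (\<lambda>m. x (Inr m)) t)))\<^sup>2) =
      (LINT t:{0..T}|lborel. (norm (complex_of_real (trig (N + 1) (\<lambda>m. ?r (Inl m)) t)))\<^sup>2)"
    unfolding set_lebesgue_integral_def
  proof (rule integral_cong_AE)
    show "AE t in lborel. indicator {0..T} t *\<^sub>R (norm (- fst ?F t - of_real (\<mu> * trig N (\<lambda>m. x (Inr m)) t)))\<^sup>2 =
        indicator {0..T} t *\<^sub>R (norm (complex_of_real (trig (N + 1) (\<lambda>m. ?r (Inl m)) t)))\<^sup>2"
      using L(3)
    proof eventually_elim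
      case (elim t)
      have "norm (- complex_of_real (trig (N + 1) (\<lambda>m. Lx (Inl m)) t) - of_real (\<mu> * trig N (\<lambda>m. x (Inr m)) t)) =
        norm (complex_of_real (trig (N + 1) (\<lambda>m. ?r (Inl m)) t))"
        unfolding of_real_minus[symmetric] of_real_diff[symmetric] r_r by simp
      with elim show ?case by (auto simp: indicator_def)
    qed
  qed (use L(1) in measurable)
  show ?thesis
    unfolding S L2_norm2_def fst_conv snd_conv 1 2 unfolding T_def parseval_trig sum_modes
    by (simp add: sum.distrib distrib_left add.commute)
qed

section \<open>Instability\<close>

theorem theorem4:
  fixes \<zeta> :: "real \<Rightarrow> real" and V0 k :: real
  assumes "admissible_kernel \<zeta>"
    and "k > 0"
  shows "\<exists>B0 > 0. \<exists>\<epsilon>0 > 0. \<forall>B \<epsilon>. 0 \<le> B \<and> B < B0 \<and> 0 \<le> \<epsilon> \<and> \<epsilon> < \<epsilon>0 \<and>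
           amplitude 1 V0 \<zeta> k \<epsilon> \<ge> 2.46 * k\<^sup>2 \<longrightarrow>
           (\<forall>n::nat. n \<ge> 1 \<longrightarrow>
             (\<exists>lam \<in> sigma_JL \<zeta> k \<epsilon> (amplitude 1 V0 \<zeta> k \<epsilon>) B (2 * pi * real n). Re lam > 0))"
proof -
  obtain d where d: "0 < d" "\<And>s. \<bar>s\<bar> < d \<Longrightarrow> 0.9 < Re (fourier \<zeta> s)"
    using fourier_near_zero[OF assms(1), of "0.9"] by auto
  show ?thesis
  \<comment> \<open>\<open>B < k\<^sup>2 / 2\<close> keeps the form negative on (1, 0). For
    \<epsilon> below d / k the frequencies k \<epsilon> and -k \<epsilon>, attached to
    \<open>\<rho> 0\<close> and \<open>\<rho> (- 1)\<close>, stay where the transform exceeds 0.9.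
    Both thresholds are independent of \<open>n\<close>.\<close>
  proof (rule exI[of _ "k\<^sup>2 / 2"], rule conjI[rotated], rule exI[of _ "d / k"], rule conjI[rotated], intro allI impI)
    fix B \<epsilon> :: real and n :: nat
    let ?A = "amplitude 1 V0 \<zeta> k \<epsilon>"
    assume "0 \<le> B \<and> B < k\<^sup>2 / 2 \<and> 0 \<le> \<epsilon> \<and> \<epsilon> < d / k \<and> 2.46 * k\<^sup>2 \<le> ?A" and n: "1 \<le> n"
    then have B: "0 \<le> B" "B < k\<^sup>2 / 2" and \<epsilon>: "0 \<le> \<epsilon>" "\<epsilon> < d / k" and A: "2.46 * k\<^sup>2 \<le> ?A" by auto
    define T where "T = 2 * pi * real n"
    have T: "0 < T" using n by (simp add: T_def)
    define \<rho> where "\<rho> j = Re (fourier \<zeta> (k * \<epsilon> * (2 * of_int j + 1)))" for j :: int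
    note fk = fourier_even_kernel[OF assms(1)]
    define \<kappa> p s where "\<kappa> = k\<^sup>2 / 2" and "p = sqrt B" and "s = sqrt (B + ?A)"
    have \<kappa>: "0 < \<kappa>" using assms(2) by (simp add: \<kappa>_def)
    have p: "0 \<le> p" "p\<^sup>2 < \<kappa>" using B by (simp_all add: p_def \<kappa>_def)
    have "0 \<le> ?A" by (rule order_trans[OF _ A]) simp
    then have "s\<^sup>2 = B + ?A" "0 \<le> s" using B by (simp_all add: s_def)
    moreover have "4.92 * \<kappa> = 2.46 * k\<^sup>2" by (simp add: \<kappa>_def)
    ultimately have s: "0 \<le> s" "4.92 * \<kappa> \<le> s\<^sup>2" using A B by (simp_all only: add_increasing)
    have \<rho>: "0 \<le> \<rho> j" "\<rho> j \<le> 1" for j using fk(6,7) less_imp_le by (auto simp: \<rho>_def)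
    have "k * \<epsilon> < d" using \<epsilon>(2) assms(2) by (simp add: field_simps)
    then have \<rho>0: "0.9 \<le> \<rho> 0" "0.9 \<le> \<rho> (- 1)"
      using d(2)[of "k * \<epsilon>"] d(2)[of "- (k * \<epsilon>)"] \<epsilon> assms(2) by (simp_all add: \<rho>_def)
    define R a where "R = \<kappa> + 2 * (p + s)\<^sup>2" and "a = \<kappa> - p\<^sup>2 * ((\<rho> (- 1) + \<rho> 0) / 2)"
    define \<delta> \<Lambda> where "\<delta> = sqrt (\<kappa> / 5 * a)" and "\<Lambda> = R * (2 + (2 * R + a) / (\<kappa> / 5))"
    have "p\<^sup>2 * ((\<rho> (- 1) + \<rho> 0) / 2) \<le> p\<^sup>2 * 1"
      by (rule mult_left_mono) (use \<rho>(2)[of 0] \<rho>(2)[of "-1"] in auto)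
    then have \<delta>: "0 < \<delta>" using p(2) \<kappa> unfolding \<delta>_def a_def by simp
    define P where "P N lam x \<longleftrightarrow> \<delta> \<le> lam \<and> lam \<le> \<Lambda> \<and> (\<forall>i. i \<notin> modes N \<longrightarrow> x i = 0) \<and> x (Inl 0) = 1 \<and>
      (\<forall>\<mu>. (\<Sum>i\<in>modes (N + 1). (L_coeff \<kappa> p s \<rho> x i + \<mu> * J_coeff x i)\<^sup>2)
         \<le> ((\<mu> - lam)\<^sup>2 + 16 * (p + s)^4 / (4 * (of_int N)\<^sup>2 - 1)) * (\<Sum>i\<in>modes N. (x i)\<^sup>2))" for N lam x
    \<comment> \<open>The shift by 1 makes every natural \<open>N\<close> an admissible
      cut-off.\<close>
    have "\<exists>lam x. P (int N + 1) lam x" for N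
      unfolding P_def \<delta>_def \<Lambda>_def R_def a_def
      by (rule approximate_eigenvector) (use \<kappa> p s \<rho> \<rho>0 in auto)
    then obtain lam X where P: "\<And>N. P (int N + 1) (lam N) (X N)" by metis
    have lam: "\<delta> \<le> lam N" "lam N \<le> \<Lambda>"
      and X: "\<And>i. i \<notin> modes (int N + 1) \<Longrightarrow> X N i = 0" and X0: "X N (Inl 0) = 1"
      and res: "\<And>\<mu>. (\<Sum>i\<in>modes (int N + 1 + 1). (L_coeff \<kappa> p s \<rho> (X N) i + \<mu> * J_coeff (X N) i)\<^sup>2)
         \<le> ((\<mu> - lam N)\<^sup>2 + 16 * (p + s)^4 / (4 * (of_int (int N + 1))\<^sup>2 - 1)) * (\<Sum>i\<in>modes (int N + 1). (X N i)\<^sup>2)"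
      for N using P[of N] unfolding P_def by blast+
    have "compact {\<delta>..\<Lambda>}" by simp
    then obtain \<mu> r where \<mu>: "\<mu> \<in> {\<delta>..\<Lambda>}" and r: "strict_mono r" "(lam \<circ> r) \<longlonglongrightarrow> \<mu>"
      unfolding compact_def using lam by (metis atLeastAtMost_iff)
    define e where "e N = (\<mu> - lam N)\<^sup>2 + 16 * (p + s)^4 / (4 * (of_int (int N + 1))\<^sup>2 - 1)" for N
    have "(\<lambda>N. 16 * (p + s)^4 / (4 * (of_int (int N + 1))\<^sup>2 - 1)) \<longlonglongrightarrow> 0"
      by real_asymp
    from LIMSEQ_subseq_LIMSEQ[OF this r(1)] have e_lim: "(\<lambda>N. e (r N)) \<longlonglongrightarrow> (\<mu> - \<mu>)\<^sup>2 + 0"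
      unfolding e_def by (intro tendsto_intros r(2)[unfolded o_def]) (simp add: o_def)
    have "of_real \<mu> \<in> sigma_JL \<zeta> k \<epsilon> ?A B T"
    proof (rule ccontr)
      assume "of_real \<mu> \<notin> sigma_JL \<zeta> k \<epsilon> ?A B T"
      then obtain C where C: "\<And>f. f \<in> sobolev 2 T \<times> sobolev 2 T \<Longrightarrow>
          L2_norm2 T f \<le> C * L2_norm2 T (shifted (J_op \<circ> L_op \<zeta> k \<epsilon> ?A B T) (of_real \<mu>) f)"
        unfolding sigma_JL_def spectrum_def resolvent_set_def by blast
      \<comment> \<open>The coefficient 1 of the constant mode gives \<open>1 \<le> S\<close>, so S
        can be cancelled from \<open>S \<le> C\<^sup>2 * (e N * S)\<close>. The vectors themselves
        need not converge.\<close>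
      have "1 \<le> C\<^sup>2 * e N" for N
      proof -
        define S where "S = (\<Sum>i\<in>modes (int N + 1). (X N i)\<^sup>2)"
        define Q where "Q = (\<Sum>i\<in>modes (int N + 1 + 1). (L_coeff \<kappa> p s \<rho> (X N) i + \<mu> * J_coeff (X N) i)\<^sup>2)"
        have "(\<Sum>i\<in>{Inl 0}. (X N i)\<^sup>2) \<le> S" unfolding S_def by (rule sum_mono2) auto
        then have S: "1 \<le> S" using X0 by simp
        have Q: "Q \<le> e N * S" "0 \<le> Q" unfolding Q_def S_def e_def using res by (auto intro: sum_nonneg)
        have shifted_norm: "L2_norm2 T (shifted (J_op \<circ> L_op \<zeta> k \<epsilon> ?A B T) (of_real \<mu>) (trig_pair (int N + 1) (X N))) = sqrt (T * Q)"
          unfolding T_def Q_def \<kappa>_def p_def s_def \<rho>_def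
          by (rule L2_norm2_shifted_trig_pair[OF assms(1,2) \<epsilon>(1) n]) (use X in blast)
        have "sqrt (T * S) \<le> C * sqrt (T * Q)"
          using C[OF trig_pair_domain[of "int N + 1" "X N" 2 n, folded T_def]]
          unfolding shifted_norm unfolding T_def L2_norm2_trig_pair S_def .
        then have "(sqrt (T * S))\<^sup>2 \<le> (C * sqrt (T * Q))\<^sup>2"
          using T S by (intro power_mono) auto
        then have "T * S \<le> C\<^sup>2 * (T * Q)"
          using T S Q by (simp add: power_mult_distrib)
        then have "S \<le> C\<^sup>2 * Q" using T by simp
        also have "\<dots> \<le> C\<^sup>2 * (e N * S)" by (rule mult_left_mono[OF Q(1)]) simp
        finally show ?thesis using S by (simp flip: mult.assoc)
      qed
      moreover have "(\<lambda>N. C\<^sup>2 * e (r N)) \<longlonglongrightarrow> C\<^sup>2 * ((\<mu> - \<mu>)\<^sup>2 + 0)"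
        by (intro tendsto_intros e_lim)
      ultimately have "1 \<le> C\<^sup>2 * ((\<mu> - \<mu>)\<^sup>2 + 0)"
        by (intro LIMSEQ_le_const[of "\<lambda>N. C\<^sup>2 * e (r N)"]) auto
      then show False by simp
    qed
    moreover have "0 < Re (of_real \<mu>)" using \<mu> \<delta> by simp
    ultimately show "\<exists>lam\<in>sigma_JL \<zeta> k \<epsilon> ?A B (2 * pi * real n). 0 < Re lam"
      unfolding T_def by blast
  qed (use d assms(2) in auto)
qed

end
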